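(* If $G$ is a group of order $32$ in which all groups of order $8$ can be embedded, then $G$ is isomorphic either to $C_2\times H_1$ or to $H_2$, where $$H_1=\langle x_2,y \mid x_2^2=y^8=1,\ x_2yx_2=y^3\rangle$$ and $$H_2=\langle x_1,x_2,y \mid x_1^2=x_2^2=y^8=1,\ [x_1,x_2]=1,\ x_1yx_1=y^5,\ x_2yx_2=y^3\rangle .$$
   Context: A group $K$ can be embedded in a group $G$ if $G$ has a subgroup isomorphic to $K$; "all groups of order $8$ can be embedded in $G$" means that every group of order $8$ is isomorphic to some subgroup of $G$. $C_2$ is the cyclic group of order 2. $H_1$ is the quasi-dihedral group of order 16, and $H_2$, of order 32, is isomorphic to the holomorph of $C_8$ (the semidirect product of $C_8$ by $\mathrm{Aut}(C_8)$). *)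

theory Defs
  imports "HOL-Algebra.Elementary_Groups"
begin

definition embeddable :: "('a, 'm) monoid_scheme \<Rightarrow> ('b, 'n) monoid_scheme \<Rightarrow> bool" where
  "embeddable K G \<longleftrightarrow> (\<exists>S. subgroup S G \<and> K \<cong> G\<lparr>carrier := S\<rparr>)"

(* HOL cannot quantify over the carrier type inside a formula. Since every finite group has an
   isomorphic copy whose elements are natural numbers, quantifying over groups on subsets of nat
   loses nothing; see all_groups_embeddable_any_type below. *)
definition all_groups_embeddable :: "nat \<Rightarrow> ('a, 'm) monoid_scheme \<Rightarrow> bool" where
  "all_groups_embeddable n G \<longleftrightarrow>
     (\<forall>K :: nat monoid. group K \<and> order K = n \<longrightarrow> embeddable K G)"

lemma all_groups_embeddable_any_type:
  fixes K :: "'b monoid"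
  assumes all: "all_groups_embeddable n G" and K: "group K" "order K = n" "n > 0"
  shows "embeddable K G"
proof -
  have fin: "finite (carrier K)"
    using K by (metis order_def card.infinite less_not_refl)
  then obtain f :: "'b \<Rightarrow> nat" where inj: "inj_on f (carrier K)"
    using finite_imp_inj_to_nat_seg by blast
  define g where "g = the_inv_into (carrier K) f"
  have g: "g (f x) = x" if "x \<in> carrier K" for x
    using that inj by (simp add: g_def the_inv_into_f_f)
  define L :: "nat monoid" where
    "L = \<lparr>carrier = f ` carrier K, mult = (\<lambda>a b. f (g a \<otimes>\<^bsub>K\<^esub> g b)), one = f \<one>\<^bsub>K\<^esub>\<rparr>"
  have iso: "f \<in> iso K L"
    using inj by (auto simp: iso_def hom_def bij_betw_def L_def g)
  interpret group K by (rule K)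
  have "group L"
  proof (rule groupI)
    fix x assume "x \<in> carrier L"
    then obtain a where a: "a \<in> carrier K" "x = f a" by (auto simp: L_def)
    show "\<exists>y\<in>carrier L. y \<otimes>\<^bsub>L\<^esub> x = \<one>\<^bsub>L\<^esub>"
      using a by (intro bexI[of _ "f (inv\<^bsub>K\<^esub> a)"]) (auto simp: L_def g)
  qed (auto simp: L_def g m_assoc)
  moreover have "order L = n"
    using K inj by (simp add: order_def L_def card_image)
  ultimately obtain S where S: "subgroup S G" "L \<cong> G\<lparr>carrier := S\<rparr>"
    using all by (auto simp: all_groups_embeddable_def embeddable_def)
  have "K \<cong> L" using iso by (rule is_isoI)
  then show ?thesis using S iso_trans by (auto simp: embeddable_def)
qed

subsection \<open>Groups given by generators and relations\<close>

(* The letter (a, True) stands for a, and (a, False) for the formal inverse of a. *)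
type_synonym 'x gword = "('x \<times> bool) list"

definition gwords :: "'x set \<Rightarrow> 'x gword set" where
  "gwords gs = lists (gs \<times> UNIV)"

definition gletter :: "'x \<Rightarrow> 'x gword" where
  "gletter a = [(a, True)]"

definition gpow :: "'x gword \<Rightarrow> nat \<Rightarrow> 'x gword" where
  "gpow w n = concat (replicate n w)"

definition ginv :: "'x gword \<Rightarrow> 'x gword" where
  "ginv w = rev (map (\<lambda>(a, b). (a, \<not> b)) w)"

definition gcomm :: "'x gword \<Rightarrow> 'x gword \<Rightarrow> 'x gword" where
  "gcomm u v = ginv u @ ginv v @ u @ v"

(* The least congruence on the words over gs that contains the free cancellations and identifies
   the two sides of every relation in R. *)
inductive pres_eq :: "'x set \<Rightarrow> ('x gword \<times> 'x gword) set \<Rightarrow> 'x gword \<Rightarrow> 'x gword \<Rightarrow> bool"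
  for gs R where
  refl: "w \<in> gwords gs \<Longrightarrow> pres_eq gs R w w"
| sym: "pres_eq gs R u v \<Longrightarrow> pres_eq gs R v u"
| trans: "pres_eq gs R u v \<Longrightarrow> pres_eq gs R v w \<Longrightarrow> pres_eq gs R u w"
| append: "pres_eq gs R u u' \<Longrightarrow> pres_eq gs R v v' \<Longrightarrow> pres_eq gs R (u @ v) (u' @ v')"
| cancel: "a \<in> gs \<Longrightarrow> pres_eq gs R [(a, b), (a, \<not> b)] []"
| relation: "(u, v) \<in> R \<Longrightarrow> u \<in> gwords gs \<Longrightarrow> v \<in> gwords gs \<Longrightarrow> pres_eq gs R u v"

definition pres_rel :: "'x set \<Rightarrow> ('x gword \<times> 'x gword) set \<Rightarrow> ('x gword \<times> 'x gword) set" where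
  "pres_rel gs R = {(u, v). pres_eq gs R u v}"

definition presented_group :: "'x set \<Rightarrow> ('x gword \<times> 'x gword) set \<Rightarrow> 'x gword set monoid" where
  "presented_group gs R =
     \<lparr>carrier = gwords gs // pres_rel gs R,
      mult = (\<lambda>A B. \<Union>u\<in>A. \<Union>v\<in>B. pres_rel gs R `` {u @ v}),
      one = pres_rel gs R `` {[]}\<rparr>"

lemma pres_eq_gwords: "pres_eq gs R u v \<Longrightarrow> u \<in> gwords gs \<and> v \<in> gwords gs"
  by (induction rule: pres_eq.induct) (auto simp: gwords_def)

lemma equiv_pres_rel: "equiv (gwords gs) (pres_rel gs R)"
  by (rule equivI)
     (auto simp: pres_rel_def refl_on_def sym_def trans_def dest: pres_eq_gwords
           intro: pres_eq.refl pres_eq.sym pres_eq.trans)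

lemma pres_class_eq_iff:
  assumes "u \<in> gwords gs" "v \<in> gwords gs"
  shows "pres_rel gs R `` {u} = pres_rel gs R `` {v} \<longleftrightarrow> pres_eq gs R u v"
  using eq_equiv_class_iff[OF equiv_pres_rel assms, of R] by (simp add: pres_rel_def)

lemma presented_group_mult:
  assumes "u \<in> gwords gs" "v \<in> gwords gs"
  shows "pres_rel gs R `` {u} \<otimes>\<^bsub>presented_group gs R\<^esub> pres_rel gs R `` {v}
         = pres_rel gs R `` {u @ v}"
proof -
  have "congruent2 (pres_rel gs R) (pres_rel gs R) (\<lambda>u v. pres_rel gs R `` {u @ v})"
  proof (rule congruent2I')
    fix u u' v v'
    assume "(u, u') \<in> pres_rel gs R" "(v, v') \<in> pres_rel gs R"
    then have "pres_eq gs R (u @ v) (u' @ v')"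
      by (auto simp: pres_rel_def intro: pres_eq.append)
    then show "pres_rel gs R `` {u @ v} = pres_rel gs R `` {u' @ v'}"
      by (meson pres_class_eq_iff pres_eq_gwords)
  qed
  then show ?thesis
    using UN_equiv_class2[OF equiv_pres_rel equiv_pres_rel _ assms]
    by (simp add: presented_group_def)
qed

lemma pres_eq_ginv:
  assumes "w \<in> gwords gs"
  shows "pres_eq gs R (ginv w @ w) []"
  using assms
proof (induction w)
  case Nil
  then show ?case by (simp add: ginv_def pres_eq.refl)
next
  case (Cons l w)
  obtain a b where l: "l = (a, b)" by (cases l)
  have a: "a \<in> gs" and w: "w \<in> gwords gs" using Cons.prems by (auto simp: gwords_def l)
  have gw: "ginv w \<in> gwords gs" using w by (auto simp: gwords_def ginv_def)
  have "pres_eq gs R ([(a, \<not> b), (a, b)] @ w) ([] @ w)"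
    using pres_eq.cancel[OF a, of R "\<not> b"] pres_eq.refl[OF w]
    by (intro pres_eq.append) auto
  then have "pres_eq gs R (ginv w @ ([(a, \<not> b), (a, b)] @ w)) (ginv w @ w)"
    using pres_eq.append[OF pres_eq.refl[OF gw]] by fastforce
  then show ?case
    using Cons.IH[OF w] by (auto simp: ginv_def l intro: pres_eq.trans)
qed

lemma group_presented_group: "group (presented_group gs R)"
proof (rule groupI)
  let ?P = "presented_group gs R" and ?c = "\<lambda>w. pres_rel gs R `` {w}"
  have ex: "\<exists>u\<in>gwords gs. x = ?c u" if "x \<in> carrier ?P" for x
    using that by (auto simp: presented_group_def elim!: quotientE)
  have cl: "?c u \<in> carrier ?P" if "u \<in> gwords gs" for u
    using that by (auto simp: presented_group_def intro: quotientI)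
  have app: "u @ v \<in> gwords gs" if "u \<in> gwords gs" "v \<in> gwords gs" for u v
    using that by (auto simp: gwords_def)
  have nil: "[] \<in> gwords gs" by (simp add: gwords_def)
  have one: "\<one>\<^bsub>?P\<^esub> = ?c []" by (simp add: presented_group_def)
  show "\<one>\<^bsub>?P\<^esub> \<in> carrier ?P" using cl nil one by simp
  fix x assume "x \<in> carrier ?P"
  then obtain u where u: "u \<in> gwords gs" "x = ?c u" using ex by blast
  show "\<one>\<^bsub>?P\<^esub> \<otimes>\<^bsub>?P\<^esub> x = x" using u nil by (simp add: one presented_group_mult)
  have gu: "ginv u \<in> gwords gs" using u by (auto simp: gwords_def ginv_def)
  have "?c (ginv u) \<otimes>\<^bsub>?P\<^esub> x = \<one>\<^bsub>?P\<^esub>"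
    using u gu nil pres_eq_ginv[OF u(1), of R]
    by (simp add: one presented_group_mult pres_class_eq_iff app)
  then show "\<exists>y\<in>carrier ?P. y \<otimes>\<^bsub>?P\<^esub> x = \<one>\<^bsub>?P\<^esub>" using cl gu by blast
  fix y assume "y \<in> carrier ?P"
  then obtain v where v: "v \<in> gwords gs" "y = ?c v" using ex by blast
  show "x \<otimes>\<^bsub>?P\<^esub> y \<in> carrier ?P" using u v by (simp add: presented_group_mult app cl)
  fix z assume "z \<in> carrier ?P"
  then obtain w where w: "w \<in> gwords gs" "z = ?c w" using ex by blast
  show "x \<otimes>\<^bsub>?P\<^esub> y \<otimes>\<^bsub>?P\<^esub> z = x \<otimes>\<^bsub>?P\<^esub> (y \<otimes>\<^bsub>?P\<^esub> z)"
    using u v w by (simp add: presented_group_mult app)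
qed

subsection \<open>The groups in question\<close>

abbreviation C2 :: "int monoid" where
  "C2 \<equiv> integer_mod_group 2"

datatype gen = GX1 | GX2 | GY

abbreviation wx1 :: "gen gword" where "wx1 \<equiv> gletter GX1"
abbreviation wx2 :: "gen gword" where "wx2 \<equiv> gletter GX2"
abbreviation wy :: "gen gword" where "wy \<equiv> gletter GY"

definition H1 :: "gen gword set monoid" where
  "H1 = presented_group {GX2, GY}
     {(gpow wx2 2, []), (gpow wy 8, []), (wx2 @ wy @ wx2, gpow wy 3)}"

definition H2 :: "gen gword set monoid" where
  "H2 = presented_group {GX1, GX2, GY}
     {(gpow wx1 2, []), (gpow wx2 2, []), (gpow wy 8, []),
      (gcomm wx1 wx2, []),
      (wx1 @ wy @ wx1, gpow wy 5), (wx2 @ wy @ wx2, gpow wy 3)}"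

end

theory Submission
  imports Defs "HOL-Algebra.Multiplicative_Group"
begin

text \<open>
  Only three of the five groups of order 8 are needed: the cyclic group, which gives an element
  \<open>y\<close> of order 8; the elementary abelian group, which gives a subgroup \<open>E\<close>; and the quaternion
  group, which gives a subgroup \<open>Q\<close>. Write \<open>Y\<close> for the subgroup generated by \<open>y\<close>, and put
  \<open>z = y\<^sup>4\<close>, its only involution. Two subgroups of order 8 of a group of order 32 cannot meet
  trivially. So \<open>z\<close> lies in \<open>E\<close>, and the unique involution of \<open>Q\<close> is \<open>z\<close>. Choosing in \<open>E\<close> a
  Klein four-group \<open>A\<close> that avoids \<open>z\<close> yields a complement of \<open>Y\<close>, so that every element is \<open>c y\<^sup>n\<close>
  for a unique \<open>c\<close> in \<open>A\<close> and \<open>n\<close> modulo 8; and \<open>Q\<close> provides two square roots of \<open>z\<close> that do not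
  commute.

  Left multiplication by \<open>y\<close> permutes the four cosets \<open>c Y\<close>, fixing \<open>Y\<close>. As a permutation of the
  other three its order divides 8, so it fixes one of them: some \<open>a \<noteq> 1\<close> in \<open>A\<close> normalises \<open>Y\<close>
  (\<open>ex_normalising\<close>). The next step shows that some \<open>c\<close> in \<open>A\<close> conjugates \<open>y\<close> to \<open>y\<^sup>3\<close> and that all
  of \<open>A\<close> normalises \<open>Y\<close> (\<open>ex_cubing\<close>). Indeed, call \<open>c\<close> inert if it conjugates \<open>y\<^sup>2\<close> to itself
  or to its inverse and the square roots of \<open>z\<close> in \<open>c Y\<close> are products of \<open>c\<close> and an even power
  of \<open>y\<close>. If \<open>c y\<^sup>2\<^sup>s\<close> squares to \<open>z\<close> for an inert \<open>c\<close>, then \<open>c\<close> must centralise \<open>y\<^sup>2\<close>,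
  since otherwise the square would be 1; hence if every element of \<open>A\<close> is inert, all square roots of
  \<open>z\<close> commute, which \<open>Q\<close> forbids. An element that does not normalise \<open>Y\<close> is inert, and so is
  one that acts on \<open>Y\<close> with an exponent 1, 5 or 7 modulo 8. So a non-inert
  element acts with exponent 3, and its presence in turn excludes elements that do not normalise \<open>Y\<close>.

  Hence \<open>G\<close> is the semidirect product of \<open>Y\<close> by \<open>A\<close>, where some \<open>c\<close> in \<open>A\<close> acts by cubing.
  Outside \<open>{1, c}\<close>, one of the two elements \<open>d, c d\<close> acts with exponent 1 or 5, because the
  units modulo 8 are \<open>1, 5\<close> and their products with 3. Exponent 1 gives the relations of
  \<open>C\<^sub>2 \<times> H\<^sub>1\<close> and exponent 5 those of \<open>H\<^sub>2\<close>. The homomorphism from the presented group to \<open>G\<close> that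
  these relations induce (\<open>von_Dyck\<close>) is onto, and normal forms \<open>c y\<^sup>n\<close> bound the order of the
  presented group by 16 or 32, so it is an isomorphism.
\<close>

section \<open>A complemented cyclic subgroup of order 8\<close>

text \<open>
  Conjugation by \<open>c\<close> is an endomorphism, so it commutes with taking powers. This form avoids
  inverses and is the rewriting step for moving a power across an element.
\<close>

lemma (in group) intertwine_int_pow:
  assumes c: "x \<in> carrier G" "x' \<in> carrier G" "c \<in> carrier G" and eq: "x \<otimes> c = c \<otimes> x'"
  shows "x [^] (n::int) \<otimes> c = c \<otimes> x' [^] n"
proof -
  define h where "h g = inv c \<otimes> g \<otimes> c" for g
  have cancel: "c \<otimes> (inv c \<otimes> w) = w" "inv c \<otimes> (c \<otimes> w) = w" if "w \<in> carrier G" for w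
    using c that by (simp_all flip: m_assoc)
  have "h \<in> hom G G" using c by (auto simp: hom_def h_def m_assoc cancel)
  then have "h (x [^] n) = h x [^] n"
    using hom_int_pow[of h G G x n] c(1) is_group by blast
  moreover have "h x = x'" using c by (simp add: h_def m_assoc eq cancel)
  ultimately have "c \<otimes> x' [^] n = c \<otimes> h (x [^] n)" by simp
  also have "\<dots> = x [^] n \<otimes> c" using c by (simp add: h_def m_assoc cancel)
  finally show ?thesis by simp
qed

text \<open>
  The situation to which the three embeddings reduce \<open>G\<close>. No normality is assumed, so at this stage
  \<open>G\<close> is only a product of two subgroups that meet trivially.
\<close>

locale klein_octic = group G for G (structure) +
  fixes A y
  assumes order_G: "order G = 32"
    and subgroup_A: "subgroup A G" and card_A: "card A = 4"
    and square_A: "c \<in> A \<Longrightarrow> c \<otimes> c = \<one>"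
    and y_closed [simp]: "y \<in> carrier G" and ord_y: "ord y = 8"
    and trivial_meet: "A \<inter> range (\<lambda>n::int. y [^] n) \<subseteq> {\<one>}"
begin

lemma A_closed [simp]: "c \<in> A \<Longrightarrow> c \<in> carrier G"
  using subgroup_A by (rule subgroup.mem_carrier)

lemma mult_A [simp]: "c \<in> A \<Longrightarrow> d \<in> A \<Longrightarrow> c \<otimes> d \<in> A"
  using subgroup_A by (rule subgroup.m_closed)

lemma one_A [simp]: "\<one> \<in> A"
  using subgroup_A by (rule subgroup.one_closed)

lemma square_A_left [simp]: "c \<in> A \<Longrightarrow> g \<in> carrier G \<Longrightarrow> c \<otimes> (c \<otimes> g) = g"
  by (simp add: square_A flip: m_assoc)

text \<open>
  A group in which every element is its own inverse is abelian.
\<close>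

lemma comm_A:
  assumes "c \<in> A" "d \<in> A" shows "c \<otimes> d = d \<otimes> c"
proof -
  have "inv x = x" if "x \<in> A" for x using that by (simp add: inv_equality square_A)
  then show ?thesis using assms by (metis A_closed inv_mult_group mult_A)
qed

lemma pow_y_eq_iff: "y [^] (m::int) = y [^] (n::int) \<longleftrightarrow> 8 dvd n - m"
  by (simp add: int_pow_eq ord_y)

lemma pow_y_mult: "y [^] (m::int) \<otimes> y [^] (n::int) = y [^] (m + n)"
  by (simp add: int_pow_mult)

lemma pow_y_mult_left:
  "g \<in> carrier G \<Longrightarrow> y [^] (m::int) \<otimes> (y [^] (n::int) \<otimes> g) = y [^] (m + n) \<otimes> g"
  by (simp add: int_pow_mult m_assoc)

lemma factorisation_unique:
  fixes m n :: int
  assumes "c \<in> A" "d \<in> A" "c \<otimes> y [^] m = d \<otimes> y [^] n"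
  shows "c = d" "8 dvd n - m"
proof -
  interpret group_disjoint_sum G A "range (\<lambda>n::int. y [^] n)"
    using subgroup_A by (simp add: group_disjoint_sum_def subgroup_of_powers)
  have "c = d \<and> y [^] m = y [^] n"
    using cancel[THEN iffD1, OF trivial_meet, rule_format, OF assms(1) rangeI assms(2) rangeI assms(3)]
    by blast
  then show "c = d" "8 dvd n - m" by (auto simp: pow_y_eq_iff)
qed

text \<open>
  By uniqueness the products with exponents \<open>0, \<dots>, 7\<close> are \<open>4 \<cdot> 8 = 32\<close> distinct elements,
  which is all of \<open>G\<close>.
\<close>

lemma factorisation_exists:
  assumes "g \<in> carrier G"
  obtains c n where "c \<in> A" "g = c \<otimes> y [^] (n::int)"
proof -
  let ?f = "\<lambda>(c, n::int). c \<otimes> y [^] n" and ?D = "A \<times> {0..<8::int}"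
  have "inj_on ?f ?D"
  proof (rule inj_onI, clarify)
    fix c d and m n :: int assume *: "c \<in> A" "d \<in> A" "m \<in> {0..<8::int}" "n \<in> {0..<8}"
      "c \<otimes> y [^] m = d \<otimes> y [^] n"
    have "8 dvd n - m" using factorisation_unique(2) * by blast
    then have "m = n" using *(3,4) by simp presburger
    then show "c = d \<and> m = n" using factorisation_unique(1) * by blast
  qed
  then have "card (?f ` ?D) = order G"
    by (simp add: card_image card_cartesian_product card_A order_G)
  moreover have "finite (carrier G)" using order_G by (metis order_gt_0_iff_finite zero_less_numeral)
  moreover have "?f ` ?D \<subseteq> carrier G" by auto
  ultimately have "?f ` ?D = carrier G" by (simp add: card_subset_eq order_def)
  with assms have "g \<in> ?f ` ?D" by simp
  then show ?thesis using that by fastforce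
qed

lemma A_exhaust:
  assumes "a \<in> A" "b \<in> A" "c \<in> A" "distinct [\<one>, a, b, c]"
  shows "A = {\<one>, a, b, c}"
proof -
  have "finite A" using card_A card.infinite by fastforce
  then show ?thesis using assms card_A by (intro card_seteq[symmetric]) auto
qed

lemma A_eq_mult:
  assumes "c \<in> A" "d \<in> A" "c \<noteq> \<one>" "d \<noteq> \<one>" "c \<noteq> d"
  shows "A = {\<one>, c, d, c \<otimes> d}" "c \<otimes> d \<notin> {\<one>, c, d}"
proof -
  have "c \<otimes> d \<noteq> c \<otimes> c" using assms by simp
  then show *: "c \<otimes> d \<notin> {\<one>, c, d}" using assms by (simp add: square_A)
  then show "A = {\<one>, c, d, c \<otimes> d}" using assms by (intro A_exhaust) auto
qed

text \<open>
  The action of \<open>y\<^sup>n\<close> on the left cosets of the subgroup generated by \<open>y\<close>, with \<open>A\<close> as the set of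
  representatives: \<open>c\<close> is related to \<open>d\<close> if \<open>y\<^sup>n\<close> maps the coset of \<open>c\<close> to that of \<open>d\<close>. Thus
  \<open>shifts 1 c c\<close> says that \<open>c\<close> normalises the cyclic subgroup.
\<close>

definition shifts :: "int \<Rightarrow> 'a \<Rightarrow> 'a \<Rightarrow> bool" where
  "shifts n c d \<longleftrightarrow> (\<exists>k::int. y [^] n \<otimes> c = d \<otimes> y [^] k)"

lemma shifts_total: "c \<in> A \<Longrightarrow> \<exists>d\<in>A. shifts n c d"
  unfolding shifts_def by (metis A_closed factorisation_exists int_pow_closed m_closed y_closed)

lemma shifts_unique: "\<lbrakk>shifts n c d; shifts n c d'; d \<in> A; d' \<in> A\<rbrakk> \<Longrightarrow> d = d'"
  unfolding shifts_def using factorisation_unique(1) by metis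

lemma shifts_add:
  assumes "shifts m c d" "shifts n d e" "c \<in> A" "d \<in> A" "e \<in> A"
  shows "shifts (n + m) c e"
proof -
  obtain k l :: int where k: "y [^] m \<otimes> c = d \<otimes> y [^] k" and l: "y [^] n \<otimes> d = e \<otimes> y [^] l"
    using assms by (auto simp: shifts_def)
  have "y [^] (n + m) \<otimes> c = y [^] n \<otimes> (y [^] m \<otimes> c)"
    using assms by (simp add: int_pow_mult m_assoc)
  also have "\<dots> = (y [^] n \<otimes> d) \<otimes> y [^] k" using assms by (simp add: k m_assoc)
  also have "\<dots> = e \<otimes> y [^] (l + k)" using assms by (simp add: l m_assoc pow_y_mult)
  finally show ?thesis by (auto simp: shifts_def)
qed

lemma shifts_uminus:
  assumes "shifts n c d" "c \<in> A" "d \<in> A" shows "shifts (-n) d c"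
proof -
  obtain k :: int where k: "y [^] n \<otimes> c = d \<otimes> y [^] k" using assms by (auto simp: shifts_def)
  have "y [^] (-n) \<otimes> d = y [^] (-n) \<otimes> (d \<otimes> y [^] k) \<otimes> y [^] (-k)"
    using assms by (simp add: m_assoc pow_y_mult)
  also have "\<dots> = c \<otimes> y [^] (-k)"
    using assms by (simp add: m_assoc pow_y_mult_left flip: k)
  finally show ?thesis by (auto simp: shifts_def)
qed

lemma shifts_one: "shifts n \<one> \<one>"
  unfolding shifts_def by (intro exI[of _ n]) simp

lemma shifts_period: "c \<in> A \<Longrightarrow> 8 dvd n \<Longrightarrow> shifts n c c"
  unfolding shifts_def by (intro exI[of _ 0]) (simp add: int_pow_eq_id ord_y)

lemma shifts_inj: "\<lbrakk>shifts n c d; shifts n c' d; c \<in> A; c' \<in> A; d \<in> A\<rbrakk> \<Longrightarrow> c = c'"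
  using shifts_unique shifts_uminus by blast

lemma shifts_1_iff: "shifts 1 c c \<longleftrightarrow> (\<exists>k::int. y \<otimes> c = c \<otimes> y [^] k)"
  by (simp add: shifts_def)

text \<open>
  The permutation induced by \<open>y\<close> on the three cosets other than the trivial one has order dividing 8.
  Without a fixed point it would be a 3-cycle: a transposition of two of the three fixes
  the third.
\<close>

lemma ex_normalising: "\<exists>a\<in>A. a \<noteq> \<one> \<and> shifts 1 a a"
proof (rule ccontr)
  assume no: "\<not> ?thesis"
  have step: "\<exists>d\<in>A. shifts 1 c d \<and> d \<noteq> \<one> \<and> d \<noteq> c" if "c \<in> A" "c \<noteq> \<one>" for c
    using that no shifts_total[of c 1] shifts_inj[OF _ shifts_one, of 1 c] by auto
  have "\<exists>c\<in>A. c \<noteq> \<one>"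
  proof (rule ccontr)
    assume "\<not> ?thesis"
    then have "A = {\<one>}" using one_A by blast
    then show False using card_A by simp
  qed
  then obtain c0 where c0: "c0 \<in> A" "c0 \<noteq> \<one>" by blast
  obtain c1 where c1: "c1 \<in> A" "c1 \<noteq> \<one>" "shifts 1 c0 c1" "c1 \<noteq> c0" using step c0 by blast
  obtain c2 where c2: "c2 \<in> A" "c2 \<noteq> \<one>" "shifts 1 c1 c2" "c2 \<noteq> c1" using step c1 by blast
  obtain c3 where c3: "c3 \<in> A" "c3 \<noteq> \<one>" "shifts 1 c2 c3" "c3 \<noteq> c2" using step c2 by blast
  show False
  proof (cases "c2 = c0")
    case True
    note A = A_eq_mult[OF c0(1) c1(1) c0(2) c1(2) c1(4)[symmetric]]
    have d: "c0 \<otimes> c1 \<in> A" "c0 \<otimes> c1 \<noteq> \<one>" using c0(1) c1(1) A(2) by simp_all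
    obtain e where e: "e \<in> A" "shifts 1 (c0 \<otimes> c1) e" "e \<noteq> \<one>" "e \<noteq> c0 \<otimes> c1"
      using step[OF d] by blast
    have "e \<noteq> c0" "e \<noteq> c1"
      using shifts_inj[OF e(2) _ d(1) _ e(1)] c0(1) c1(1,3) c2(3) True A(2) by blast+
    then show False using e A(1) by blast
  next
    case False
    then have A: "A = {\<one>, c0, c1, c2}" using c0 c1 c2 by (intro A_exhaust) auto
    have "c3 \<noteq> c1" using shifts_inj[OF c3(3), of c0] c0 c1 c2 False by blast
    then have "c3 = c0" using A c3 by blast
    then have 3: "shifts 3 c0 c0"
      using shifts_add[OF shifts_add[OF c1(3) c2(3)] c3(3)] c0 c1 c2 by simp
    \<comment> \<open>the cube of a 3-cycle is trivial, so \<open>y\<^sup>9\<close> fixes \<open>c0\<close>; but \<open>y\<^sup>9 = y\<close>\<close>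
    have "shifts 9 c0 c0" using shifts_add[OF shifts_add[OF 3 3] 3] c0 by simp
    then have "shifts 1 c0 c0" using shifts_add[OF _ shifts_period[of c0 "-8"]] c0 by fastforce
    then show False using no c0 by blast
  qed
qed

lemma normalising_pow:
  assumes "c \<in> A" "y \<otimes> c = c \<otimes> y [^] (i::int)"
  shows "y [^] (n::int) \<otimes> c = c \<otimes> y [^] (i * n)"
  using intertwine_int_pow[OF _ _ _ assms(2)] assms(1) by (simp add: int_pow_pow)

text \<open>
  Conjugating twice by the involution \<open>c\<close> shows \<open>i\<^sup>2 \<equiv> 1\<close> modulo 8.
\<close>

lemma normalising_odd:
  assumes "c \<in> A" "y \<otimes> c = c \<otimes> y [^] (i::int)"
  shows "odd i"
proof -
  have "y = y \<otimes> c \<otimes> c" using assms(1) by (simp add: m_assoc square_A)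
  also have "\<dots> = c \<otimes> (y [^] i \<otimes> c)" unfolding assms(2) using assms(1) by (simp add: m_assoc)
  also have "\<dots> = y [^] (i * i)" unfolding normalising_pow[OF assms] using assms(1) by simp
  finally have "y [^] (1::int) = y [^] (i * i)" by simp
  then have "8 dvd i * i - 1" by (simp only: pow_y_eq_iff)
  then have "even (i * i - 1)" by (rule dvd_trans[rotated]) simp
  then show ?thesis by simp
qed

lemma square_normalising:
  assumes "c \<in> A" "y \<otimes> c = c \<otimes> y [^] (i::int)"
  shows "(c \<otimes> y [^] (n::int)) \<otimes> (c \<otimes> y [^] n) = y [^] ((i + 1) * n)"
proof -
  have "(c \<otimes> y [^] n) \<otimes> (c \<otimes> y [^] n) = c \<otimes> ((y [^] n \<otimes> c) \<otimes> y [^] n)"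
    using assms(1) by (simp add: m_assoc)
  also have "\<dots> = y [^] (i * n + n)"
    unfolding normalising_pow[OF assms] using assms(1) by (simp add: m_assoc pow_y_mult)
  finally show ?thesis by (simp add: distrib_right)
qed

end

section \<open>Square roots of the involution in the cyclic subgroup\<close>

lemma mod_eq_4: "8 dvd 4 - p \<Longrightarrow> p mod 8 = 4" for p :: int
  by presburger

lemma succ_times_mod: "((i + 1) * n) mod k = ((i mod k + 1) * (n mod k)) mod k" for i n k :: int
  by (rule mod_mult_cong) (simp_all add: mod_simps)

context klein_octic
begin

text \<open>
  If every element of \<open>A\<close> is inert, then the square roots of \<open>y\<^sup>4\<close> commute with each other, which is
  what the quaternion subgroup contradicts. The condition on \<open>e\<close> says that \<open>y\<^sup>e\<close> generates the same
  subgroup as \<open>y\<^sup>2\<close>, so \<open>c\<close> either centralises or inverts \<open>y\<^sup>2\<close>; the second part forbids square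
  roots of \<open>y\<^sup>4\<close> of the form \<open>c y\<^sup>n\<close> with odd \<open>n\<close>.
\<close>

definition inert :: "'a \<Rightarrow> bool" where
  "inert c \<longleftrightarrow> (\<exists>e::int. e mod 4 = 2 \<and> y [^] (2::int) \<otimes> c = c \<otimes> y [^] e) \<and>
     (\<forall>n::int. (c \<otimes> y [^] n) \<otimes> (c \<otimes> y [^] n) = y [^] (4::int) \<longrightarrow> even n)"

text \<open>
  The square of \<open>c y\<^sup>n\<close> is \<open>y\<close> to the power \<open>(i + 1) n\<close>. For odd \<open>n\<close> this exponent is 4 modulo 8
  only if \<open>i + 1\<close> is.
\<close>

lemma inert_normalising:
  assumes c: "c \<in> A" "y \<otimes> c = c \<otimes> y [^] (i::int)" and i: "i mod 8 \<noteq> 3"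
  shows "inert c"
  unfolding inert_def
proof (intro conjI exI allI impI)
  have "odd i" using normalising_odd[OF c] .
  then show "(i * 2) mod 4 = 2" by presburger
  show "y [^] (2::int) \<otimes> c = c \<otimes> y [^] (i * 2)" by (rule normalising_pow[OF c])
  fix n :: int
  assume "(c \<otimes> y [^] n) \<otimes> (c \<otimes> y [^] n) = y [^] (4::int)"
  then have "8 dvd 4 - (i + 1) * n" by (simp only: square_normalising[OF c] pow_y_eq_iff)
  then have 4: "((i mod 8 + 1) * (n mod 8)) mod 8 = 4"
    using mod_eq_4[of "(i + 1) * n"] by (simp only: succ_times_mod[of i n 8])
  show "even n"
  proof (rule ccontr)
    assume "odd n"
    then have "n mod 8 = 1 \<or> n mod 8 = 3 \<or> n mod 8 = 5 \<or> n mod 8 = 7" by presburger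
    moreover have "i mod 8 = 1 \<or> i mod 8 = 5 \<or> i mod 8 = 7" using \<open>odd i\<close> i by presburger
    ultimately show False using 4 by auto
  qed
qed

lemma even_pow_intertwine:
  assumes "c \<in> A" "y [^] (2::int) \<otimes> c = c \<otimes> y [^] (e::int)"
  shows "y [^] (2 * s::int) \<otimes> c = c \<otimes> y [^] (e * s)"
  using intertwine_int_pow[OF _ _ _ assms(2), of s] assms(1) by (simp add: int_pow_pow)

text \<open>
  If \<open>c\<close> inverted \<open>y\<^sup>2\<close>, then every \<open>c y\<^sup>2\<^sup>s\<close> would have trivial square. So \<open>c\<close> centralises \<open>y\<^sup>2\<close>
  as soon as its coset contains a square root of \<open>y\<^sup>4\<close>.
\<close>

lemma inert_root:
  fixes n :: int
  assumes "c \<in> A" "inert c" and root: "(c \<otimes> y [^] n) \<otimes> (c \<otimes> y [^] n) = y [^] (4::int)"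
  shows "even n" "\<And>m. even m \<Longrightarrow> y [^] (m::int) \<otimes> c = c \<otimes> y [^] m"
proof -
  obtain e :: int where e: "e mod 4 = 2" "y [^] (2::int) \<otimes> c = c \<otimes> y [^] e"
    using assms by (auto simp: inert_def)
  show "even n" using assms by (auto simp: inert_def)
  then obtain s where s: "n = 2 * s" by blast
  have "y [^] (4::int) = c \<otimes> (y [^] (2 * s) \<otimes> c \<otimes> y [^] (2 * s))"
    using assms(1) by (simp add: m_assoc s flip: root)
  also have "\<dots> = y [^] ((e + 2) * s)"
    unfolding even_pow_intertwine[OF assms(1) e(2)] using assms(1)
    by (simp add: m_assoc pow_y_mult distrib_right)
  finally have 8: "8 dvd (e + 2) * s - 4" by (simp only: pow_y_eq_iff)
  have "e mod 8 = 2"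
  proof (rule ccontr)
    assume "e mod 8 \<noteq> 2"
    then have "8 dvd e + 2" using e(1) by presburger
    then have "8 dvd (e + 2) * s" by simp
    then show False using dvd_diff[OF _ 8] by fastforce
  qed
  then have "8 dvd 2 - e" by presburger
  then have "y [^] e = y [^] (2::int)" by (simp only: pow_y_eq_iff)
  then have e2: "y [^] (2::int) \<otimes> c = c \<otimes> y [^] (2::int)" using e(2) by simp
  show "y [^] m \<otimes> c = c \<otimes> y [^] m" if "even m" for m :: int
    using that even_pow_intertwine[OF assms(1) e2] by (auto elim!: evenE)
qed

lemma inert_roots_commute:
  assumes inert: "\<And>c. c \<in> A \<Longrightarrow> inert c"
    and uv: "u \<in> carrier G" "v \<in> carrier G"
    and roots: "u \<otimes> u = y [^] (4::int)" "v \<otimes> v = y [^] (4::int)"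
  shows "u \<otimes> v = v \<otimes> u"
proof -
  obtain c m where c: "c \<in> A" "u = c \<otimes> y [^] (m::int)" using factorisation_exists uv by metis
  obtain d n where d: "d \<in> A" "v = d \<otimes> y [^] (n::int)" using factorisation_exists uv by metis
  note rc = inert_root[OF c(1) inert[OF c(1)] roots(1)[unfolded c(2)]]
  note rd = inert_root[OF d(1) inert[OF d(1)] roots(2)[unfolded d(2)]]
  have "u \<otimes> v = c \<otimes> (y [^] m \<otimes> d) \<otimes> y [^] n" using c(1) d(1) by (simp add: c(2) d(2) m_assoc)
  also have "\<dots> = c \<otimes> d \<otimes> y [^] (m + n)"
    unfolding rd(2)[OF rc(1)] using c(1) d(1) by (simp add: m_assoc pow_y_mult)
  also have "\<dots> = d \<otimes> c \<otimes> y [^] (n + m)"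
    by (simp only: comm_A[OF c(1) d(1)] add.commute)
  also have "\<dots> = d \<otimes> (y [^] n \<otimes> c) \<otimes> y [^] m"
    unfolding rc(2)[OF rd(1)] using c(1) d(1) by (simp add: m_assoc pow_y_mult)
  also have "\<dots> = v \<otimes> u" using c(1) d(1) by (simp add: c(2) d(2) m_assoc)
  finally show ?thesis .
qed

text \<open>
  Since \<open>y\<close> fixes the cosets of \<open>1\<close> and \<open>a\<close>, it can move the coset of \<open>c\<close> only to the one
  that remains.
\<close>

lemma moved_coset:
  assumes a: "a \<in> A" "a \<noteq> \<one>" "shifts 1 a a" and c: "c \<in> A" "\<not> shifts 1 c c"
  obtains k where "y \<otimes> c = c \<otimes> (a \<otimes> y [^] (k::int))"
proof -
  obtain d where d: "d \<in> A" "shifts 1 c d" using shifts_total c by blast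
  have "c \<noteq> \<one>" "c \<noteq> a" using shifts_one a c by auto
  have "d \<noteq> c" using c d by auto
  moreover have "d \<noteq> \<one>" using shifts_inj[OF d(2) _ c(1) one_A d(1)] shifts_one \<open>c \<noteq> \<one>\<close> by blast
  moreover have "d \<noteq> a" using shifts_inj[OF d(2) _ c(1) a(1) d(1)] a(3) \<open>c \<noteq> a\<close> by blast
  moreover have "A = {\<one>, c, a, c \<otimes> a}"
    using A_eq_mult(1)[OF c(1) a(1) \<open>c \<noteq> \<one>\<close> a(2) \<open>c \<noteq> a\<close>] .
  ultimately have "d = c \<otimes> a" using d(1) by blast
  then show ?thesis using that d(2) a(1) c(1) by (auto simp: shifts_def m_assoc)
qed

text \<open>
  Conjugation by \<open>c\<close> takes \<open>y\<close> to \<open>a y\<^sup>k\<close>, hence \<open>y\<^sup>2\<close> to \<open>(a y\<^sup>k)\<^sup>2 = y\<^sup>e\<close> with \<open>e = (i + 1) k\<close>. This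
  has order 4, which forces \<open>e \<equiv> 2\<close> modulo 4 and, as \<open>i\<close> is odd, \<open>i \<equiv> 1\<close> modulo 4. For odd \<open>n\<close>
  the power \<open>y\<^sup>n\<close> moves the coset of \<open>c\<close> to that of \<open>c a\<close>, so the square of \<open>c y\<^sup>n\<close> lies in the
  coset of \<open>a\<close> and is not \<open>y\<^sup>4\<close>.
\<close>

lemma moved_coset_inert:
  assumes a: "a \<in> A" "a \<noteq> \<one>" "y \<otimes> a = a \<otimes> y [^] (i::int)"
    and c: "c \<in> A" "y \<otimes> c = c \<otimes> (a \<otimes> y [^] (k::int))"
  shows "inert c" "i mod 4 = 1"
proof -
  define e where "e = (i + 1) * k"
  have pow: "y [^] n \<otimes> c = c \<otimes> (a \<otimes> y [^] k) [^] n" for n :: int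
    using intertwine_int_pow[OF _ _ _ c(2)] a(1) c(1) by simp
  have "(a \<otimes> y [^] k) [^] (2::int) = y [^] e"
    using square_normalising[OF a(1,3), of k] a(1) int_pow_mult[of "a \<otimes> y [^] k" 1 1]
    by (simp add: e_def)
  then have 2: "y [^] (2::int) \<otimes> c = c \<otimes> y [^] e" using pow[of 2] by simp
  have "\<not> 8 dvd e * 2"
  proof
    assume "8 dvd e * 2"
    then have "y [^] (e * 2) = \<one>" by (simp add: int_pow_eq_id ord_y)
    then have "y [^] (4::int) \<otimes> c = \<one> \<otimes> c"
      using even_pow_intertwine[OF c(1) 2, of 2] c(1) by simp
    then have "y [^] (4::int) = \<one>" using c(1) by simp
    then show False by (simp add: int_pow_eq_id ord_y)
  qed
  moreover have "odd i" using normalising_odd a by blast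
  ultimately have e: "e mod 4 = 2" and i: "i mod 4 = 1"
  proof -
    have e': "e mod 4 = ((i mod 4 + 1) * (k mod 4)) mod 4" unfolding e_def by (rule succ_times_mod)
    have "i mod 4 = 1 \<or> i mod 4 = 3" using \<open>odd i\<close> by presburger
    moreover have "k mod 4 = 0 \<or> k mod 4 = 1 \<or> k mod 4 = 2 \<or> k mod 4 = 3" by presburger
    moreover have "e mod 4 \<noteq> 0" using \<open>\<not> 8 dvd e * 2\<close> by presburger
    ultimately show "e mod 4 = 2" "i mod 4 = 1" using e' by auto
  qed
  show "i mod 4 = 1" by (rule i)
  have "even n" if root: "(c \<otimes> y [^] n) \<otimes> (c \<otimes> y [^] n) = y [^] (4::int)" for n :: int
  proof (rule ccontr)
    assume "odd n"
    then obtain t where "n = 2 * t + 1" by (rule oddE)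
    then have t: "n = 1 + 2 * t" by simp
    have "y [^] n \<otimes> c = y \<otimes> (y [^] (2 * t) \<otimes> c)"
      using c(1) by (simp add: t int_pow_mult m_assoc)
    also have "\<dots> = (y \<otimes> c) \<otimes> y [^] (e * t)"
      unfolding even_pow_intertwine[OF c(1) 2] using c(1) by (simp add: m_assoc)
    also have "\<dots> = c \<otimes> (a \<otimes> y [^] (k + e * t))"
      unfolding c(2) using a(1) c(1) by (simp add: m_assoc pow_y_mult)
    finally have n: "y [^] n \<otimes> c = c \<otimes> (a \<otimes> y [^] (k + e * t))" .
    have "\<one> \<otimes> y [^] (4::int) = c \<otimes> ((y [^] n \<otimes> c) \<otimes> y [^] n)"
      using c(1) by (simp add: m_assoc flip: root)
    also have "\<dots> = a \<otimes> y [^] (k + e * t + n)"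
      unfolding n using a(1) c(1) by (simp add: m_assoc pow_y_mult)
    finally show False using factorisation_unique(1)[OF one_A a(1)] a(2) by metis
  qed
  then show "inert c" unfolding inert_def using 2 e by blast
qed

lemma exponent_cong:
  fixes k l :: int
  assumes "y \<otimes> g = g \<otimes> y [^] k" "k mod 8 = l mod 8"
  shows "y \<otimes> g = g \<otimes> y [^] l"
proof -
  have "8 dvd l - k" using assms(2) by presburger
  then have "y [^] k = y [^] l" by (simp only: pow_y_eq_iff)
  then show ?thesis using assms(1) by simp
qed

lemma cubing_neq_one:
  assumes "y \<otimes> c = c \<otimes> y [^] (3::int)"
  shows "c \<noteq> \<one>"
proof
  assume "c = \<one>"
  then have "y [^] (1::int) = y [^] (3::int)" using assms by simp
  then have "8 dvd 3 - (1::int)" by (simp only: pow_y_eq_iff)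
  then show False by simp
qed

text \<open>
  By \<open>inert_roots_commute\<close> some \<open>c\<close> is not inert. It normalises the cyclic subgroup, for otherwise it
  would be inert by \<open>moved_coset_inert\<close>, and its exponent is then 3. If \<open>d\<close> did not normalise,
  \<open>moved_coset_inert\<close> could be applied with \<open>c\<close> in the role of \<open>a\<close>, and would give \<open>3 \<equiv> 1\<close>
  modulo 4.
\<close>

lemma ex_cubing:
  assumes uv: "u \<in> carrier G" "v \<in> carrier G" "u \<otimes> v \<noteq> v \<otimes> u"
    and roots: "u \<otimes> u = y [^] (4::int)" "v \<otimes> v = y [^] (4::int)"
  obtains c where "c \<in> A" "y \<otimes> c = c \<otimes> y [^] (3::int)"
    "\<And>d. d \<in> A \<Longrightarrow> \<exists>i::int. y \<otimes> d = d \<otimes> y [^] i"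
proof -
  obtain c where c: "c \<in> A" "\<not> inert c" using inert_roots_commute uv roots by blast
  obtain a i where a: "a \<in> A" "a \<noteq> \<one>" "y \<otimes> a = a \<otimes> y [^] (i::int)"
    using ex_normalising by (auto simp: shifts_1_iff)
  have "shifts 1 a a" using a by (auto simp: shifts_1_iff)
  have "shifts 1 c c"
    using moved_coset[OF a(1,2) \<open>shifts 1 a a\<close> c(1)] moved_coset_inert(1)[OF a c(1)] c(2) by blast
  then obtain j where j: "y \<otimes> c = c \<otimes> y [^] (j::int)" by (auto simp: shifts_1_iff)
  then have j3: "j mod 8 = 3" using inert_normalising c by blast
  have c3: "y \<otimes> c = c \<otimes> y [^] (3::int)" by (rule exponent_cong[OF j]) (simp add: j3)
  then have "c \<noteq> \<one>" by (rule cubing_neq_one)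
  have "shifts 1 d d" if d: "d \<in> A" for d
  proof (rule ccontr)
    assume "\<not> shifts 1 d d"
    then obtain k where "y \<otimes> d = d \<otimes> (c \<otimes> y [^] (k::int))"
      using moved_coset[OF c(1) \<open>c \<noteq> \<one>\<close> \<open>shifts 1 c c\<close> d \<open>\<not> shifts 1 d d\<close>] by blast
    from moved_coset_inert(2)[OF c(1) \<open>c \<noteq> \<one>\<close> c3 d this] show False by simp
  qed
  then show ?thesis using that c(1) c3 by (auto simp: shifts_1_iff)
qed

text \<open>
  Multiplying \<open>d\<close> by \<open>c\<close> multiplies its exponent by 3, which exchanges 1 with 3 and 5 with 7.
\<close>

lemma ex_complementary_action:
  assumes c: "c \<in> A" "y \<otimes> c = c \<otimes> y [^] (3::int)"
    and norm: "\<And>d. d \<in> A \<Longrightarrow> \<exists>i::int. y \<otimes> d = d \<otimes> y [^] i"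
  obtains d i where "A = {\<one>, c, d, c \<otimes> d}" "d \<in> A" "y \<otimes> d = d \<otimes> y [^] (i::int)" "i = 1 \<or> i = 5"
proof -
  have c1: "c \<noteq> \<one>" using c(2) by (rule cubing_neq_one)
  have "\<exists>d\<in>A. d \<noteq> \<one> \<and> d \<noteq> c"
  proof (rule ccontr)
    assume "\<not> ?thesis"
    then have "A = {\<one>, c}" using c by auto
    then show False using card_A c1 by simp
  qed
  then obtain d where d: "d \<in> A" "d \<noteq> \<one>" "c \<noteq> d" by blast
  obtain i :: int where i: "y \<otimes> d = d \<otimes> y [^] i" using norm d by blast
  have cd: "y \<otimes> (c \<otimes> d) = (c \<otimes> d) \<otimes> y [^] (i * 3)"
  proof -
    have "y \<otimes> (c \<otimes> d) = (y \<otimes> c) \<otimes> d" using c(1) d(1) by (simp add: m_assoc)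
    also have "\<dots> = c \<otimes> (y [^] (3::int) \<otimes> d)"
      unfolding c(2) using c(1) d(1) by (simp add: m_assoc)
    finally show ?thesis
      unfolding normalising_pow[OF d(1) i] using c(1) d(1) by (simp add: m_assoc)
  qed
  note dA = A_eq_mult[OF c(1) d(1) c1 d(2) d(3)]
  have cdA: "c \<otimes> d \<in> A" "c \<otimes> d \<noteq> \<one>" "c \<noteq> c \<otimes> d"
    using mult_A[OF c(1) d(1)] dA(2) by (blast, blast, metis insertCI)
  note cdA' = A_eq_mult(1)[OF c(1) cdA(1) c1 cdA(2) cdA(3)]
  have "odd i" using normalising_odd d i by blast
  then have "i mod 8 = 1 \<or> i mod 8 = 5 \<or> (i * 3) mod 8 = 1 \<or> (i * 3) mod 8 = 5" by presburger
  then consider "i mod 8 = 1" | "i mod 8 = 5" | "(i * 3) mod 8 = 1" | "(i * 3) mod 8 = 5" by blast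
  then show ?thesis
  proof cases
    case 1
    have "y \<otimes> d = d \<otimes> y [^] (1::int)" by (rule exponent_cong[OF i]) (simp add: 1)
    then show ?thesis using that[OF dA(1) d(1)] by blast
  next
    case 2
    have "y \<otimes> d = d \<otimes> y [^] (5::int)" by (rule exponent_cong[OF i]) (simp add: 2)
    then show ?thesis using that[OF dA(1) d(1)] by blast
  next
    case 3
    have "y \<otimes> (c \<otimes> d) = (c \<otimes> d) \<otimes> y [^] (1::int)" by (rule exponent_cong[OF cd]) (simp add: 3)
    then show ?thesis using that[OF cdA' cdA(1)] by blast
  next
    case 4
    have "y \<otimes> (c \<otimes> d) = (c \<otimes> d) \<otimes> y [^] (5::int)" by (rule exponent_cong[OF cd]) (simp add: 4)
    then show ?thesis using that[OF cdA' cdA(1)] by blast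
  qed
qed

end

section \<open>Presented groups\<close>

abbreviation gclass :: "'x set \<Rightarrow> ('x gword \<times> 'x gword) set \<Rightarrow> 'x gword \<Rightarrow> 'x gword set" where
  "gclass gs R w \<equiv> pres_rel gs R `` {w}"

definition (in group) eval_word :: "('x \<Rightarrow> 'a) \<Rightarrow> 'x gword \<Rightarrow> 'a" where
  "eval_word f w = foldr (\<lambda>(a, b) g. (if b then f a else inv (f a)) \<otimes> g) w \<one>"

context group
begin

lemma eval_word_Nil [simp]: "eval_word f [] = \<one>"
  by (simp add: eval_word_def)

lemma eval_word_Cons [simp]:
  "eval_word f ((a, b) # w) = (if b then f a else inv (f a)) \<otimes> eval_word f w"
  by (simp add: eval_word_def)

lemma eval_word_closed:
  "\<lbrakk>f ` gs \<subseteq> carrier G; w \<in> gwords gs\<rbrakk> \<Longrightarrow> eval_word f w \<in> carrier G"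
  by (induction w) (auto simp: gwords_def)

lemma eval_word_append:
  "\<lbrakk>f ` gs \<subseteq> carrier G; u \<in> gwords gs; v \<in> gwords gs\<rbrakk>
    \<Longrightarrow> eval_word f (u @ v) = eval_word f u \<otimes> eval_word f v"
proof (induction u)
  case Nil
  then show ?case by (simp add: eval_word_closed)
next
  case (Cons l u)
  obtain a b where l: "l = (a, b)" by (cases l)
  have "a \<in> gs" "u \<in> gwords gs" using Cons.prems by (auto simp: gwords_def l)
  then show ?case using Cons eval_word_closed[of f gs]
    by (auto simp: l m_assoc image_subset_iff)
qed

text \<open>
  Equality of values in \<open>G\<close> is a congruence that contains the free cancellations and \<open>R\<close>, so it
  contains the least such congruence.
\<close>

lemma eval_word_pres_eq:
  assumes f: "f ` gs \<subseteq> carrier G"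
    and R: "\<And>u v. (u, v) \<in> R \<Longrightarrow> eval_word f u = eval_word f v"
  shows "pres_eq gs R u v \<Longrightarrow> eval_word f u = eval_word f v"
proof (induction rule: pres_eq.induct)
  case (append u u' v v')
  then show ?case using pres_eq_gwords[of gs R] by (metis eval_word_append f)
next
  case (cancel a b)
  then have "f a \<in> carrier G" using f by blast
  then show ?case by (cases b) auto
qed (auto simp: R)

lemma von_Dyck:
  assumes f: "f ` gs \<subseteq> carrier G"
    and R: "\<And>u v. (u, v) \<in> R \<Longrightarrow> eval_word f u = eval_word f v"
  obtains \<phi> where "\<phi> \<in> hom (presented_group gs R) G"
    "\<And>w. w \<in> gwords gs \<Longrightarrow> \<phi> (gclass gs R w) = eval_word f w"
proof -
  \<comment> \<open>well defined because evaluation is constant on each class\<close>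
  define \<phi> where "\<phi> X = the_elem (eval_word f ` X)" for X
  have \<phi>: "\<phi> (gclass gs R w) = eval_word f w" if w: "w \<in> gwords gs" for w
  proof -
    have "w \<in> gclass gs R w" using pres_eq.refl[OF w] by (simp add: pres_rel_def)
    moreover have "eval_word f v = eval_word f w" if "v \<in> gclass gs R w" for v
    proof -
      have "pres_eq gs R w v" using that by (simp add: pres_rel_def)
      from eval_word_pres_eq[OF f R this] show ?thesis by simp
    qed
    ultimately have "eval_word f ` gclass gs R w = {eval_word f w}" by blast
    then show ?thesis by (simp add: \<phi>_def)
  qed
  have "\<phi> \<in> hom (presented_group gs R) G"
  proof (rule homI)
    fix X assume "X \<in> carrier (presented_group gs R)"
    then obtain u where u: "u \<in> gwords gs" "X = gclass gs R u"
      by (auto simp: presented_group_def elim!: quotientE)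
    then show "\<phi> X \<in> carrier G" using \<phi> eval_word_closed f by auto
    fix Y assume "Y \<in> carrier (presented_group gs R)"
    then obtain v where v: "v \<in> gwords gs" "Y = gclass gs R v"
      by (auto simp: presented_group_def elim!: quotientE)
    have "u @ v \<in> gwords gs" using u v by (simp add: gwords_def)
    then show "\<phi> (X \<otimes>\<^bsub>presented_group gs R\<^esub> Y) = \<phi> X \<otimes> \<phi> Y"
      using u v \<phi> f by (simp add: presented_group_mult eval_word_append)
  qed
  then show ?thesis using that \<phi> by blast
qed

end

lemma gclass_closed: "w \<in> gwords gs \<Longrightarrow> gclass gs R w \<in> carrier (presented_group gs R)"
  by (auto simp: presented_group_def intro: quotientI)

text \<open>
  Evaluation at the generators of the presented group itself returns the class of the word. This allows
  a single computation of what the relations mean in an arbitrary group to serve both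
  for the presented group and for the target of a homomorphism.
\<close>

lemma eval_word_presented_group:
  assumes "w \<in> gwords gs"
  shows "group.eval_word (presented_group gs R) (\<lambda>a. gclass gs R (gletter a)) w = gclass gs R w"
proof -
  interpret P: group "presented_group gs R" by (rule group_presented_group)
  have one: "\<one>\<^bsub>presented_group gs R\<^esub> = gclass gs R []" by (simp add: presented_group_def)
  show ?thesis using assms
  proof (induction w)
    case Nil
    then show ?case by (simp add: one)
  next
    case (Cons l w)
    obtain a b where l: "l = (a, b)" by (cases l)
    have a: "a \<in> gs" and w: "w \<in> gwords gs" using Cons.prems by (auto simp: gwords_def l)
    have letter: "[(a, b)] \<in> gwords gs" for b using a by (simp add: gwords_def)
    have "gclass gs R [(a, False)] \<otimes>\<^bsub>presented_group gs R\<^esub> gclass gs R [(a, True)]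
        = \<one>\<^bsub>presented_group gs R\<^esub>"
      using pres_eq.cancel[OF a, of R False] letter
      by (simp add: presented_group_mult one pres_class_eq_iff gwords_def)
    then have "inv\<^bsub>presented_group gs R\<^esub> gclass gs R (gletter a) = gclass gs R [(a, False)]"
      using letter by (intro P.inv_equality) (auto simp: gletter_def intro: gclass_closed)
    then have "(if b then gclass gs R (gletter a)
         else inv\<^bsub>presented_group gs R\<^esub> gclass gs R (gletter a)) = gclass gs R [(a, b)]"
      by (cases b) (simp_all add: gletter_def)
    then show ?case using Cons.IH[OF w] letter[of b] w
      by (simp add: l presented_group_mult del: if_not_P)
  qed
qed

lemma relation_holds:
  assumes "(u, v) \<in> R" "u \<in> gwords gs" "v \<in> gwords gs"
  defines "f \<equiv> \<lambda>a. gclass gs R (gletter a)"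
  shows "group.eval_word (presented_group gs R) f u = group.eval_word (presented_group gs R) f v"
  using assms eval_word_presented_group[of _ gs R]
  by (simp add: pres_class_eq_iff pres_eq.relation)

text \<open>
  Every word arises by prepending letters to the empty word, so a set that contains the unit and is closed under
  left multiplication by generators and their inverses is everything.
\<close>

lemma presented_group_subset:
  assumes one: "\<one>\<^bsub>presented_group gs R\<^esub> \<in> S"
    and step: "\<And>a s. \<lbrakk>a \<in> gs; s \<in> S\<rbrakk> \<Longrightarrow>
      gclass gs R (gletter a) \<otimes>\<^bsub>presented_group gs R\<^esub> s \<in> S \<and>
      inv\<^bsub>presented_group gs R\<^esub> gclass gs R (gletter a) \<otimes>\<^bsub>presented_group gs R\<^esub> s \<in> S"
  shows "carrier (presented_group gs R) \<subseteq> S"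
proof
  interpret P: group "presented_group gs R" by (rule group_presented_group)
  fix X assume "X \<in> carrier (presented_group gs R)"
  then obtain w where w: "w \<in> gwords gs" "X = gclass gs R w"
    by (auto simp: presented_group_def elim!: quotientE)
  have "P.eval_word (\<lambda>a. gclass gs R (gletter a)) w \<in> S"
    using w(1) by (induction w) (use one step in \<open>auto simp: gwords_def\<close>)
  then show "X \<in> S" using eval_word_presented_group w by metis
qed

context group
begin

lemma normal_form_left_mult:
  assumes C: "C \<subseteq> carrier G" and y: "y \<in> carrier G"
    and norm: "\<And>c. c \<in> C \<Longrightarrow> \<exists>m::int. y \<otimes> c = c \<otimes> y [^] m"
    and g: "g \<in> (\<lambda>(c, n::int). c \<otimes> y [^] n) ` (C \<times> UNIV)"
  shows "y [^] (k::int) \<otimes> g \<in> (\<lambda>(c, n::int). c \<otimes> y [^] n) ` (C \<times> UNIV)"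
proof -
  obtain c n where c: "c \<in> C" "g = c \<otimes> y [^] (n::int)" using g by auto
  obtain m :: int where m: "y \<otimes> c = c \<otimes> y [^] m" using norm c by blast
  have cc: "c \<in> carrier G" using C c by blast
  have "y [^] k \<otimes> g = (y [^] k \<otimes> c) \<otimes> y [^] n" using y cc by (simp add: c(2) m_assoc)
  also have "\<dots> = c \<otimes> y [^] (m * k + n)"
    unfolding intertwine_int_pow[OF y int_pow_closed[OF y] cc m]
    using y cc by (simp add: int_pow_pow int_pow_mult m_assoc)
  finally show ?thesis using c(1) by auto
qed

text \<open>
  Exponents matter only modulo 8.
\<close>

lemma normal_form_card:
  assumes "finite C" "y \<in> carrier G" "y [^] (8::nat) = \<one>"
  defines "S \<equiv> (\<lambda>(c, n::int). c \<otimes> y [^] n) ` (C \<times> UNIV)"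
  shows "finite S" "card S \<le> card C * 8"
proof -
  let ?T = "(\<lambda>(c, n::int). c \<otimes> y [^] n) ` (C \<times> {0..<8})"
  have "y [^] (n mod 8) = y [^] n" for n :: int
  proof -
    have "int (ord y) dvd 8"
      using pow_eq_id[OF assms(2), of 8] assms(3) by (metis int_dvd_int_iff of_nat_numeral)
    moreover have "8 dvd n - n mod 8" by simp
    ultimately show ?thesis using assms(2) int_pow_eq dvd_trans by blast
  qed
  then have "c \<otimes> y [^] n \<in> ?T" if "c \<in> C" for c and n :: int
    using that by (intro image_eqI[of _ _ "(c, n mod 8)"]) auto
  then have sub: "S \<subseteq> ?T" unfolding S_def by auto
  have fin: "finite (C \<times> {0..<8::int})" using assms(1) by simp
  then show "finite S" using sub finite_subset by blast
  have "card S \<le> card ?T" using sub fin by (intro card_mono) auto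
  also have "\<dots> \<le> card (C \<times> {0..<8::int})" using fin by (rule card_image_le)
  finally show "card S \<le> card C * 8" by (simp add: card_cartesian_product)
qed

lemma eval_word_gpow:
  "\<lbrakk>f ` gs \<subseteq> carrier G; w \<in> gwords gs\<rbrakk> \<Longrightarrow> eval_word f (gpow w n) = eval_word f w [^] n"
proof (induction n)
  case 0 then show ?case by (simp add: gpow_def)
next
  case (Suc n)
  have "gpow w n \<in> gwords gs" using Suc.prems by (auto simp: gpow_def gwords_def)
  then have "eval_word f (gpow w (Suc n)) = eval_word f w \<otimes> eval_word f w [^] n"
    using Suc eval_word_append[of f gs w "gpow w n"] by (simp add: gpow_def)
  then show ?case using nat_pow_Suc2[of "eval_word f w" n] eval_word_closed[OF Suc.prems] by simp
qed

lemma conjugation_by_involution: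
  assumes "x \<in> carrier G" "y \<in> carrier G" "x \<otimes> x = \<one>"
  shows "x \<otimes> y \<otimes> x = y [^] (n::nat) \<longleftrightarrow> y \<otimes> x = x \<otimes> y [^] int n"
proof -
  have cancel: "x \<otimes> (x \<otimes> g) = g" if "g \<in> carrier G" for g
    using that assms by (simp flip: m_assoc)
  show ?thesis
  proof
    assume "x \<otimes> y \<otimes> x = y [^] n"
    then have "x \<otimes> (x \<otimes> y \<otimes> x) = x \<otimes> y [^] int n" by (simp add: int_pow_int)
    then show "y \<otimes> x = x \<otimes> y [^] int n" using assms cancel by (simp add: m_assoc)
  next
    assume "y \<otimes> x = x \<otimes> y [^] int n"
    then have "x \<otimes> (y \<otimes> x) = x \<otimes> (x \<otimes> y [^] n)" by (simp add: int_pow_int)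
    then show "x \<otimes> y \<otimes> x = y [^] n" using assms cancel by (simp add: m_assoc)
  qed
qed

lemma commutator_eq_one_iff:
  assumes "x \<in> carrier G" "y \<in> carrier G"
  shows "inv x \<otimes> inv y \<otimes> x \<otimes> y = \<one> \<longleftrightarrow> x \<otimes> y = y \<otimes> x"
proof -
  have "inv x \<otimes> inv y \<otimes> x \<otimes> y = inv (y \<otimes> x) \<otimes> (x \<otimes> y)"
    using assms by (simp add: inv_mult_group m_assoc)
  then show ?thesis using assms inv_solve_left'[of "\<one>" "y \<otimes> x" "x \<otimes> y"] by simp
qed

end

abbreviation H1_rels :: "(gen gword \<times> gen gword) set" where
  "H1_rels \<equiv> {(gpow wx2 2, []), (gpow wy 8, []), (wx2 @ wy @ wx2, gpow wy 3)}"

abbreviation H2_rels :: "(gen gword \<times> gen gword) set" where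
  "H2_rels \<equiv> {(gpow wx1 2, []), (gpow wx2 2, []), (gpow wy 8, []), (gcomm wx1 wx2, []),
     (wx1 @ wy @ wx1, gpow wy 5), (wx2 @ wy @ wx2, gpow wy 3)}"

text \<open>
  The conjugation relations are turned into rules for moving \<open>y\<close> past an involution, which is the form
  needed for collecting words.
\<close>

lemma (in group) H1_relations_iff:
  assumes "f ` {GX2, GY} \<subseteq> carrier G"
  shows "(\<forall>(u, v)\<in>H1_rels. eval_word f u = eval_word f v) \<longleftrightarrow>
    f GX2 \<otimes> f GX2 = \<one> \<and> f GY [^] (8::nat) = \<one> \<and> f GY \<otimes> f GX2 = f GX2 \<otimes> f GY [^] (3::int)"
proof -
  have letter: "gletter GX2 \<in> gwords {GX2, GY}" "gletter GY \<in> gwords {GX2, GY}"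
    by (simp_all add: gletter_def gwords_def)
  have f: "f GX2 \<in> carrier G" "f GY \<in> carrier G" using assms by auto
  have 2: "f GX2 [^] (2::nat) = f GX2 \<otimes> f GX2" using f by (simp add: numeral_2_eq_2)
  have "f GX2 \<otimes> f GY \<otimes> f GX2 = f GY [^] (3::nat) \<longleftrightarrow> f GY \<otimes> f GX2 = f GX2 \<otimes> f GY [^] (3::int)"
    if "f GX2 \<otimes> f GX2 = \<one>"
    using conjugation_by_involution[OF f that, of 3] by simp
  then show ?thesis using letter f
    by (auto simp: eval_word_gpow[OF assms] 2 gletter_def m_assoc)
qed

lemma (in group) H2_relations_iff:
  assumes "f ` {GX1, GX2, GY} \<subseteq> carrier G"
  shows "(\<forall>(u, v)\<in>H2_rels. eval_word f u = eval_word f v) \<longleftrightarrow>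
    f GX1 \<otimes> f GX1 = \<one> \<and> f GX2 \<otimes> f GX2 = \<one> \<and> f GY [^] (8::nat) = \<one> \<and>
    f GX1 \<otimes> f GX2 = f GX2 \<otimes> f GX1 \<and>
    f GY \<otimes> f GX1 = f GX1 \<otimes> f GY [^] (5::int) \<and> f GY \<otimes> f GX2 = f GX2 \<otimes> f GY [^] (3::int)"
proof -
  have letter: "gletter GX1 \<in> gwords {GX1, GX2, GY}" "gletter GX2 \<in> gwords {GX1, GX2, GY}"
    "gletter GY \<in> gwords {GX1, GX2, GY}"
    by (simp_all add: gletter_def gwords_def)
  have f: "f GX1 \<in> carrier G" "f GX2 \<in> carrier G" "f GY \<in> carrier G" using assms by auto
  have 2: "f GX1 [^] (2::nat) = f GX1 \<otimes> f GX1" "f GX2 [^] (2::nat) = f GX2 \<otimes> f GX2"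
    using f by (simp_all add: numeral_2_eq_2)
  have "f GX2 \<otimes> f GY \<otimes> f GX2 = f GY [^] (3::nat) \<longleftrightarrow> f GY \<otimes> f GX2 = f GX2 \<otimes> f GY [^] (3::int)"
    if "f GX2 \<otimes> f GX2 = \<one>"
    using conjugation_by_involution[OF f(2,3) that, of 3] by simp
  moreover have "f GX1 \<otimes> f GY \<otimes> f GX1 = f GY [^] (5::nat) \<longleftrightarrow> f GY \<otimes> f GX1 = f GX1 \<otimes> f GY [^] (5::int)"
    if "f GX1 \<otimes> f GX1 = \<one>"
    using conjugation_by_involution[OF f(1,3) that, of 5] by simp
  ultimately show ?thesis using letter f commutator_eq_one_iff[OF f(1,2)]
    by (auto simp: eval_word_gpow[OF assms] 2 gletter_def m_assoc gcomm_def ginv_def)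
qed

text \<open>
  If the generators other than \<open>b\<close> square to 1 and permute a finite set \<open>C\<close> by left multiplication,
  and \<open>b\<close> can be moved to the right past each element of \<open>C\<close>, then every word collects to \<open>c b\<^sup>n\<close>
  with \<open>c\<close> in \<open>C\<close>.
\<close>

lemma presented_group_card:
  fixes gs :: "'x set" and R
  defines "P \<equiv> presented_group gs R" and "f \<equiv> \<lambda>a. gclass gs R (gletter a)"
  assumes b: "b \<in> gs" "f b [^]\<^bsub>P\<^esub> (8::nat) = \<one>\<^bsub>P\<^esub>"
    and C: "C \<subseteq> carrier P" "finite C" "\<one>\<^bsub>P\<^esub> \<in> C"
    and norm: "\<And>c. c \<in> C \<Longrightarrow> \<exists>m::int. f b \<otimes>\<^bsub>P\<^esub> c = c \<otimes>\<^bsub>P\<^esub> f b [^]\<^bsub>P\<^esub> m"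
    and inv: "\<And>a. a \<in> gs \<Longrightarrow> a \<noteq> b \<Longrightarrow> f a \<otimes>\<^bsub>P\<^esub> f a = \<one>\<^bsub>P\<^esub>"
    and act: "\<And>a c. \<lbrakk>a \<in> gs; a \<noteq> b; c \<in> C\<rbrakk> \<Longrightarrow> f a \<otimes>\<^bsub>P\<^esub> c \<in> C"
  shows "finite (carrier P)" "card (carrier P) \<le> card C * 8"
proof -
  interpret group P unfolding P_def by (rule group_presented_group)
  let ?S = "(\<lambda>(c, n::int). c \<otimes>\<^bsub>P\<^esub> f b [^]\<^bsub>P\<^esub> n) ` (C \<times> UNIV)"
  have fc: "f a \<in> carrier P" if "a \<in> gs" for a
    using that unfolding f_def P_def by (intro gclass_closed) (simp add: gletter_def gwords_def)
  have aS: "f a \<otimes>\<^bsub>P\<^esub> s \<in> ?S" if a: "a \<in> gs" "a \<noteq> b" and s: "s \<in> ?S" for a s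
  proof -
    obtain c n where c: "c \<in> C" "s = c \<otimes>\<^bsub>P\<^esub> f b [^]\<^bsub>P\<^esub> (n::int)" using s by auto
    then have "f a \<otimes>\<^bsub>P\<^esub> s = (f a \<otimes>\<^bsub>P\<^esub> c) \<otimes>\<^bsub>P\<^esub> f b [^]\<^bsub>P\<^esub> n"
      using C(1) fc[OF a(1)] fc[OF b(1)] by (auto simp: m_assoc)
    then show ?thesis using act[OF a c(1)] by auto
  qed
  have bS: "f b [^]\<^bsub>P\<^esub> (k::int) \<otimes>\<^bsub>P\<^esub> s \<in> ?S" if "s \<in> ?S" for s k
    using normal_form_left_mult[OF C(1) fc[OF b(1)] norm that] .
  have sub: "carrier P \<subseteq> ?S"
    unfolding P_def
  proof (rule presented_group_subset, unfold P_def[symmetric])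
    show "\<one>\<^bsub>P\<^esub> \<in> ?S" using C(3) by (intro image_eqI[of _ _ "(\<one>\<^bsub>P\<^esub>, 0)"]) auto
    fix a s assume a: "a \<in> gs" and s: "s \<in> ?S"
    have "f a \<otimes>\<^bsub>P\<^esub> s \<in> ?S \<and> inv\<^bsub>P\<^esub> f a \<otimes>\<^bsub>P\<^esub> s \<in> ?S"
    proof (cases "a = b")
      case True
      then show ?thesis using bS[OF s, of 1] bS[OF s, of "-1"] fc[OF b(1)]
        by (simp only: int_pow_1 int_pow_neg simp_thms)
    next
      case False
      then have "inv\<^bsub>P\<^esub> f a = f a" using inv a fc[OF a] by (simp add: inv_equality)
      then show ?thesis using aS[OF a False s] by simp
    qed
    then show "gclass gs R (gletter a) \<otimes>\<^bsub>P\<^esub> s \<in> ?S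
        \<and> inv\<^bsub>P\<^esub> gclass gs R (gletter a) \<otimes>\<^bsub>P\<^esub> s \<in> ?S"
      by (simp only: f_def)
  qed
  note card = normal_form_card[OF C(2) fc[OF b(1)] b(2)]
  show "finite (carrier P)" using sub card(1) by (rule finite_subset)
  have "card (carrier P) \<le> card ?S" using sub card(1) by (rule card_mono[rotated])
  then show "card (carrier P) \<le> card C * 8" using card(2) by (rule le_trans)
qed

lemma H1_card: "finite (carrier H1)" "card (carrier H1) \<le> 16"
proof -
  let ?gs = "{GX2, GY}"
  interpret group H1 unfolding H1_def by (rule group_presented_group)
  define f where "f a = gclass ?gs H1_rels (gletter a)" for a
  have f: "f ` ?gs \<subseteq> carrier H1"
    by (auto simp: f_def H1_def gletter_def gwords_def intro!: gclass_closed)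
  have "\<forall>(u, v)\<in>H1_rels. eval_word f u = eval_word f v"
    unfolding f_def H1_def
    by (intro ballI, clarify, rule relation_holds)
      (auto simp: gletter_def gwords_def gpow_def)
  then have x: "f GX2 \<otimes>\<^bsub>H1\<^esub> f GX2 = \<one>\<^bsub>H1\<^esub>" and y8: "f GY [^]\<^bsub>H1\<^esub> (8::nat) = \<one>\<^bsub>H1\<^esub>"
    and yx: "f GY \<otimes>\<^bsub>H1\<^esub> f GX2 = f GX2 \<otimes>\<^bsub>H1\<^esub> f GY [^]\<^bsub>H1\<^esub> (3::int)"
    unfolding H1_relations_iff[OF f] by blast+
  have fc: "f GX2 \<in> carrier H1" "f GY \<in> carrier H1" using f by auto
  define C where "C = {\<one>\<^bsub>H1\<^esub>, f GX2}"
  have C: "C \<subseteq> carrier H1" "finite C" "\<one>\<^bsub>H1\<^esub> \<in> C" using fc by (auto simp: C_def)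
  have "\<exists>m::int. f GY \<otimes>\<^bsub>H1\<^esub> c = c \<otimes>\<^bsub>H1\<^esub> f GY [^]\<^bsub>H1\<^esub> m" if "c \<in> C" for c
    using that yx fc by (auto simp: C_def intro: exI[of _ 1])
  moreover have "f a \<otimes>\<^bsub>H1\<^esub> f a = \<one>\<^bsub>H1\<^esub>" if "a \<in> ?gs" "a \<noteq> GY" for a
    using that x by auto
  moreover have "f a \<otimes>\<^bsub>H1\<^esub> c \<in> C" if "a \<in> ?gs" "a \<noteq> GY" "c \<in> C" for a c
  proof -
    have "f a = f GX2" using that by blast
    then show ?thesis using that(3) x r_one[OF fc(1)] unfolding C_def by fastforce
  qed
  ultimately have "finite (carrier H1)" "card (carrier H1) \<le> card C * 8"
    using presented_group_card[of GY ?gs H1_rels C] y8 C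
    unfolding f_def[symmetric] H1_def[symmetric] by blast+
  moreover have "card C \<le> 2" by (simp add: C_def card_insert_if)
  ultimately show "finite (carrier H1)" "card (carrier H1) \<le> 16" by auto
qed

lemma H2_card: "finite (carrier H2)" "card (carrier H2) \<le> 32"
proof -
  let ?gs = "{GX1, GX2, GY}"
  interpret group H2 unfolding H2_def by (rule group_presented_group)
  define f where "f a = gclass ?gs H2_rels (gletter a)" for a
  define x1 x2 y where "x1 = f GX1" and "x2 = f GX2" and "y = f GY"
  have f: "f ` ?gs \<subseteq> carrier H2"
    by (auto simp: f_def H2_def gletter_def gwords_def intro!: gclass_closed)
  have "\<forall>(u, v)\<in>H2_rels. eval_word f u = eval_word f v"
    unfolding f_def H2_def
    by (intro ballI, clarify, rule relation_holds)
      (auto simp: gletter_def gwords_def gpow_def gcomm_def ginv_def)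
  then have inv: "x1 \<otimes>\<^bsub>H2\<^esub> x1 = \<one>\<^bsub>H2\<^esub>" "x2 \<otimes>\<^bsub>H2\<^esub> x2 = \<one>\<^bsub>H2\<^esub>" and y8: "y [^]\<^bsub>H2\<^esub> (8::nat) = \<one>\<^bsub>H2\<^esub>"
    and xx: "x1 \<otimes>\<^bsub>H2\<^esub> x2 = x2 \<otimes>\<^bsub>H2\<^esub> x1"
    and yx: "y \<otimes>\<^bsub>H2\<^esub> x1 = x1 \<otimes>\<^bsub>H2\<^esub> y [^]\<^bsub>H2\<^esub> (5::int)" "y \<otimes>\<^bsub>H2\<^esub> x2 = x2 \<otimes>\<^bsub>H2\<^esub> y [^]\<^bsub>H2\<^esub> (3::int)"
    unfolding H2_relations_iff[OF f] x1_def x2_def y_def by blast+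
  have fc: "x1 \<in> carrier H2" "x2 \<in> carrier H2" "y \<in> carrier H2"
    using f by (auto simp: x1_def x2_def y_def)
  define C where "C = {\<one>\<^bsub>H2\<^esub>, x1, x2, x1 \<otimes>\<^bsub>H2\<^esub> x2}"
  have C: "C \<subseteq> carrier H2" "finite C" "\<one>\<^bsub>H2\<^esub> \<in> C" using fc by (auto simp: C_def)
  have yxx: "y \<otimes>\<^bsub>H2\<^esub> (x1 \<otimes>\<^bsub>H2\<^esub> x2) = (x1 \<otimes>\<^bsub>H2\<^esub> x2) \<otimes>\<^bsub>H2\<^esub> y [^]\<^bsub>H2\<^esub> (15::int)"
  proof -
    have "y \<otimes>\<^bsub>H2\<^esub> (x1 \<otimes>\<^bsub>H2\<^esub> x2) = (y \<otimes>\<^bsub>H2\<^esub> x1) \<otimes>\<^bsub>H2\<^esub> x2" using fc by (simp add: m_assoc)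
    also have "\<dots> = x1 \<otimes>\<^bsub>H2\<^esub> (y [^]\<^bsub>H2\<^esub> (5::int) \<otimes>\<^bsub>H2\<^esub> x2)" unfolding yx using fc by (simp add: m_assoc)
    also have "\<dots> = (x1 \<otimes>\<^bsub>H2\<^esub> x2) \<otimes>\<^bsub>H2\<^esub> y [^]\<^bsub>H2\<^esub> (15::int)"
      unfolding intertwine_int_pow[OF fc(3) int_pow_closed[OF fc(3)] fc(2) yx(2)]
      using fc by (simp add: int_pow_pow m_assoc)
    finally show ?thesis .
  qed
  have "\<exists>m::int. y \<otimes>\<^bsub>H2\<^esub> c = c \<otimes>\<^bsub>H2\<^esub> y [^]\<^bsub>H2\<^esub> m" if "c \<in> C" for c
  proof -
    have "y \<otimes>\<^bsub>H2\<^esub> \<one>\<^bsub>H2\<^esub> = \<one>\<^bsub>H2\<^esub> \<otimes>\<^bsub>H2\<^esub> y [^]\<^bsub>H2\<^esub> (1::int)" using fc by simp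
    then show ?thesis using that yx yxx unfolding C_def by blast
  qed
  moreover have "f a \<otimes>\<^bsub>H2\<^esub> f a = \<one>\<^bsub>H2\<^esub>" if "a \<in> ?gs" "a \<noteq> GY" for a
    using that inv unfolding x1_def x2_def by blast
  moreover have "f a \<otimes>\<^bsub>H2\<^esub> c \<in> C" if "a \<in> ?gs" "a \<noteq> GY" "c \<in> C" for a c
  proof -
    have "x1 \<otimes>\<^bsub>H2\<^esub> (x1 \<otimes>\<^bsub>H2\<^esub> x2) = x2" using fc inv by (simp flip: m_assoc)
    moreover have "x2 \<otimes>\<^bsub>H2\<^esub> (x1 \<otimes>\<^bsub>H2\<^esub> x2) = x1" unfolding xx using fc inv by (simp flip: m_assoc)
    moreover have "x2 \<otimes>\<^bsub>H2\<^esub> x1 = x1 \<otimes>\<^bsub>H2\<^esub> x2" using xx by simp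
    moreover have "f a = x1 \<or> f a = x2" using that unfolding x1_def x2_def by blast
    ultimately show ?thesis using that(3) inv fc r_one unfolding C_def by fastforce
  qed
  ultimately have "finite (carrier H2)" "card (carrier H2) \<le> card C * 8"
    using presented_group_card[of GY ?gs H2_rels C] y8 C
    unfolding y_def f_def[symmetric] H2_def[symmetric] by blast+
  moreover have "card C \<le> 4" by (simp add: C_def card_insert_if)
  ultimately show "finite (carrier H2)" "card (carrier H2) \<le> 32" by auto
qed

section \<open>Identification of the semidirect products\<close>

text \<open>
  A homomorphism onto \<open>G\<close> from a group that is no larger than \<open>G\<close> is injective.
\<close>

lemma iso_by_card:
  assumes "group P" "h \<in> hom P G" "carrier G \<subseteq> h ` carrier P"
    and "finite (carrier P)" "card (carrier P) \<le> card (carrier G)"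
  shows "G \<cong> P"
proof -
  have surj: "h ` carrier P = carrier G" using assms(2,3) by (auto simp: hom_def)
  moreover have "inj_on h (carrier P)"
    using assms(4,5) surj card_image_le[OF assms(4), of h] by (intro eq_card_imp_inj_on) auto
  ultimately have "h \<in> iso P G" using assms(2) by (simp add: iso_iff)
  then show ?thesis by (intro group.iso_sym[OF assms(1)] is_isoI)
qed

context klein_octic
begin

lemma generated:
  assumes "A = {\<one>, c, d, c \<otimes> d}" and K: "subgroup K G" "c \<in> K" "d \<in> K" "y \<in> K"
  shows "carrier G \<subseteq> K"
proof
  fix g assume "g \<in> carrier G"
  then obtain e n where g: "e \<in> A" "g = e \<otimes> y [^] (n::int)" by (rule factorisation_exists)
  have "e = \<one> \<or> e = c \<or> e = d \<or> e = c \<otimes> d" using g(1) unfolding assms(1) by blast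
  then have "e \<in> K" using K subgroup.one_closed[OF K(1)] subgroup.m_closed[OF K(1-3)] by blast
  moreover have "y [^] n \<in> K" using subgroup_int_pow_closed[OF K(1,4)] .
  ultimately show "g \<in> K" unfolding g(2) by (rule subgroup.m_closed[OF K(1)])
qed

lemma y_pow_8: "y [^] (8::nat) = \<one>"
  by (simp add: pow_eq_id ord_y)

lemma iso_H2:
  assumes A: "A = {\<one>, c, d, c \<otimes> d}"
    and c: "y \<otimes> c = c \<otimes> y [^] (3::int)" and d: "y \<otimes> d = d \<otimes> y [^] (5::int)"
  shows "G \<cong> H2"
proof -
  define f where "f = case_gen d c y"
  have cd: "c \<in> A" "d \<in> A" unfolding A by blast+
  have f: "f ` {GX1, GX2, GY} \<subseteq> carrier G" using cd by (auto simp: f_def)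
  have R: "\<forall>(u, v)\<in>H2_rels. eval_word f u = eval_word f v"
    unfolding H2_relations_iff[OF f]
    using cd c d comm_A[OF cd] y_pow_8 square_A by (simp add: f_def)
  obtain \<phi> where \<phi>: "\<phi> \<in> hom H2 G"
    "\<And>w. w \<in> gwords {GX1, GX2, GY} \<Longrightarrow> \<phi> (gclass {GX1, GX2, GY} H2_rels w) = eval_word f w"
    unfolding H2_def by (rule von_Dyck[OF f, of H2_rels]) (use R in blast)+
  interpret \<phi>: group_hom H2 G \<phi>
    using \<phi>(1) by (simp add: group_hom_def group_hom_axioms_def H2_def group_presented_group)
  have "f a \<in> \<phi> ` carrier H2" for a
  proof -
    have w: "gletter a \<in> gwords {GX1, GX2, GY}" by (cases a) (auto simp: gletter_def gwords_def)
    have "f a \<in> carrier G" using f by (cases a) auto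
    then have "f a = \<phi> (gclass {GX1, GX2, GY} H2_rels (gletter a))"
      by (simp add: \<phi>(2)[OF w]) (simp add: gletter_def)
    then show ?thesis using gclass_closed[OF w] unfolding H2_def by blast
  qed
  from this[of GX1] this[of GX2] this[of GY]
  have "carrier G \<subseteq> \<phi> ` carrier H2"
    by (intro generated[OF A \<phi>.img_is_subgroup]) (simp_all add: f_def)
  then show ?thesis
    using iso_by_card[OF \<phi>.G.is_group \<phi>(1)] H2_card order_G by (simp add: order_def)
qed

text \<open>
  The element \<open>d\<close> commutes with \<open>y\<close> and with \<open>A\<close>, so it is central. Therefore
  \<open>(m, h) \<mapsto> d\<^sup>m \<phi>(h)\<close> is a homomorphism on the direct product, where \<open>\<phi>\<close> is the one that the
  relations of \<open>H\<^sub>1\<close> induce.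
\<close>

lemma iso_C2_times_H1:
  assumes A: "A = {\<one>, c, d, c \<otimes> d}"
    and c: "y \<otimes> c = c \<otimes> y [^] (3::int)" and d: "y \<otimes> d = d \<otimes> y"
  shows "G \<cong> C2 \<times>\<times> H1"
proof -
  define f where "f = case_gen d c y"
  have cd: "c \<in> A" "d \<in> A" unfolding A by blast+
  have f: "f ` {GX2, GY} \<subseteq> carrier G" using cd by (auto simp: f_def)
  have R: "\<forall>(u, v)\<in>H1_rels. eval_word f u = eval_word f v"
    unfolding H1_relations_iff[OF f] using cd c y_pow_8 square_A by (simp add: f_def)
  obtain \<phi> where \<phi>: "\<phi> \<in> hom H1 G"
    "\<And>w. w \<in> gwords {GX2, GY} \<Longrightarrow> \<phi> (gclass {GX2, GY} H1_rels w) = eval_word f w"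
    unfolding H1_def by (rule von_Dyck[OF f, of H1_rels]) (use R in blast)+
  interpret \<phi>: group_hom H1 G \<phi>
    using \<phi>(1) by (simp add: group_hom_def group_hom_axioms_def H1_def group_presented_group)
  have central: "g \<otimes> d = d \<otimes> g" if g: "g \<in> carrier G" for g
  proof -
    obtain e n where e: "e \<in> A" "g = e \<otimes> y [^] (n::int)" using g by (rule factorisation_exists)
    have "g \<otimes> d = e \<otimes> (y [^] n \<otimes> d)" using e cd by (simp add: m_assoc)
    also have "\<dots> = (e \<otimes> d) \<otimes> y [^] n"
      using intertwine_int_pow[OF y_closed y_closed _ d] e cd by (simp add: m_assoc)
    also have "\<dots> = d \<otimes> g" unfolding comm_A[OF e(1) cd(2)] using e cd by (simp add: m_assoc)
    finally show ?thesis .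
  qed
  define \<psi> where "\<psi> p = d [^] (fst p :: int) \<otimes> \<phi> (snd p)" for p
  have dc: "d \<in> carrier G" using cd by simp
  have d2: "d [^] ((m + n) mod 2) = d [^] m \<otimes> d [^] n" for m n :: int
  proof -
    have "d [^] (2::nat) = \<one>" using square_A[OF cd(2)] dc by (simp add: numeral_2_eq_2)
    then have "ord d dvd 2" using pow_eq_id[OF dc] by blast
    then have "int (ord d) dvd 2" by (metis int_dvd_int_iff of_nat_numeral)
    moreover have "2 dvd (m + n) - (m + n) mod 2" by simp
    ultimately have "d [^] ((m + n) mod 2) = d [^] (m + n)" using int_pow_eq[OF dc] dvd_trans by blast
    then show ?thesis using dc by (simp add: int_pow_mult)
  qed
  have \<psi>: "\<psi> \<in> hom (C2 \<times>\<times> H1) G"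
  proof (rule homI)
    fix p assume "p \<in> carrier (C2 \<times>\<times> H1)"
    then have p: "snd p \<in> carrier H1" by auto
    then show "\<psi> p \<in> carrier G" using dc by (simp add: \<psi>_def)
    fix q assume "q \<in> carrier (C2 \<times>\<times> H1)"
    then have q: "snd q \<in> carrier H1" by auto
    have swap: "d [^] fst q \<otimes> \<phi> (snd p) = \<phi> (snd p) \<otimes> d [^] fst q"
      using intertwine_int_pow[of d d "\<phi> (snd p)"] dc p central by simp
    have "\<psi> (p \<otimes>\<^bsub>C2 \<times>\<times> H1\<^esub> q) = d [^] fst p \<otimes> (d [^] fst q \<otimes> \<phi> (snd p)) \<otimes> \<phi> (snd q)"
      using p q dc by (simp add: \<psi>_def mult_DirProd' d2 m_assoc)
    also have "\<dots> = \<psi> p \<otimes> \<psi> q" unfolding swap using p q dc by (simp add: \<psi>_def m_assoc)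
    finally show "\<psi> (p \<otimes>\<^bsub>C2 \<times>\<times> H1\<^esub> q) = \<psi> p \<otimes> \<psi> q" .
  qed
  have grp: "group (C2 \<times>\<times> H1)" using \<phi>.G.is_group by (intro DirProd_group) simp_all
  interpret \<psi>: group_hom "C2 \<times>\<times> H1" G \<psi>
    using \<psi> grp by (simp add: group_hom_def group_hom_axioms_def)
  have img: "\<psi> (m, h) \<in> \<psi> ` carrier (C2 \<times>\<times> H1)" if "m \<in> {0, 1}" "h \<in> carrier H1" for m h
    using that by (intro imageI) (auto simp: carrier_integer_mod_group)
  have "f a \<in> \<psi> ` carrier (C2 \<times>\<times> H1)" if a: "a \<in> {GX2, GY}" for a
  proof -
    have w: "gletter a \<in> gwords {GX2, GY}" using a by (simp add: gletter_def gwords_def)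
    have "f a \<in> carrier G" using f a by blast
    then have "f a = \<psi> (0, gclass {GX2, GY} H1_rels (gletter a))"
      by (simp add: \<psi>_def \<phi>(2)[OF w]) (simp add: gletter_def)
    then show ?thesis using img[of 0] gclass_closed[OF w, of H1_rels] unfolding H1_def by simp
  qed
  from this[of GX2] this[of GY]
  have gen: "c \<in> \<psi> ` carrier (C2 \<times>\<times> H1)" "y \<in> \<psi> ` carrier (C2 \<times>\<times> H1)"
    by (simp_all add: f_def)
  have "d = \<psi> (1, \<one>\<^bsub>H1\<^esub>)" using dc by (simp add: \<psi>_def)
  then have "d \<in> \<psi> ` carrier (C2 \<times>\<times> H1)" using img[of 1 "\<one>\<^bsub>H1\<^esub>"] by simp
  then have "carrier G \<subseteq> \<psi> ` carrier (C2 \<times>\<times> H1)"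
    using gen by (intro generated[OF A \<psi>.img_is_subgroup])
  moreover have "finite (carrier (C2 \<times>\<times> H1))" "card (carrier (C2 \<times>\<times> H1)) \<le> card (carrier G)"
    using H1_card order_G by (simp_all add: card_cartesian_product carrier_integer_mod_group order_def)
  ultimately show ?thesis by (rule iso_by_card[OF grp \<psi>])
qed

end

section \<open>Consequences of the embeddings\<close>

lemma embeddable_imp_hom:
  assumes "embeddable K G"
  obtains f where "f \<in> hom K G" "inj_on f (carrier K)"
proof -
  obtain S f where S: "subgroup S G" and f: "f \<in> iso K (G\<lparr>carrier := S\<rparr>)"
    using assms by (auto simp: embeddable_def is_iso_def)
  have "f \<in> hom K G" using f subgroup.subset[OF S] by (auto simp: iso_def hom_def)
  then show ?thesis using that f by (auto simp: iso_iff)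
qed

text \<open>
  The quaternion group as the units \<open>\<plusminus>1, \<plusminus>i, \<plusminus>j, \<plusminus>k\<close> of the Lipschitz integers. With Hamilton's
  product on all integer quadruples, associativity is a polynomial identity
  and not an inspection of \<open>8\<^sup>3\<close> cases.
\<close>

type_synonym quat = "int \<times> int \<times> int \<times> int"

fun quat_mult :: "quat \<Rightarrow> quat \<Rightarrow> quat" where
  "quat_mult (a, b, c, d) (a', b', c', d') =
    (a * a' - b * b' - c * c' - d * d', a * b' + b * a' + c * d' - d * c',
     a * c' - b * d' + c * a' + d * b', a * d' + b * c' - c * b' + d * a')"

definition Q8 :: "quat monoid" where
  "Q8 = \<lparr>carrier = {(1,0,0,0), (-1,0,0,0), (0,1,0,0), (0,-1,0,0),
                     (0,0,1,0), (0,0,-1,0), (0,0,0,1), (0,0,0,-1)},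
         mult = quat_mult, one = (1,0,0,0)\<rparr>"

lemma group_Q8: "group Q8"
proof (rule groupI)
  fix p assume "p \<in> carrier Q8"
  then show "\<exists>q\<in>carrier Q8. q \<otimes>\<^bsub>Q8\<^esub> p = \<one>\<^bsub>Q8\<^esub>" by (auto simp: Q8_def)
next
  fix p q r :: quat
  show "p \<otimes>\<^bsub>Q8\<^esub> q \<otimes>\<^bsub>Q8\<^esub> r = p \<otimes>\<^bsub>Q8\<^esub> (q \<otimes>\<^bsub>Q8\<^esub> r)"
    by (cases p; cases q; cases r) (simp add: Q8_def algebra_simps)
qed (auto simp: Q8_def)

lemma order_Q8: "order Q8 = 8"
  by (simp add: order_def Q8_def)

context group
begin

text \<open>
  If the subgroups met trivially, their products would be pairwise distinct and too many.
\<close>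

lemma large_subgroups_meet:
  assumes H: "subgroup H G" and K: "subgroup K G" and fin: "finite (carrier G)"
    and card: "order G < card H * card K"
  obtains g where "g \<in> H" "g \<in> K" "g \<noteq> \<one>"
proof -
  have "\<not> H \<inter> K \<subseteq> {\<one>}"
  proof
    assume triv: "H \<inter> K \<subseteq> {\<one>}"
    interpret group_disjoint_sum G H K
      using H K by (simp add: group_disjoint_sum_def)
    have "inj_on (\<lambda>(h, k). h \<otimes> k) (H \<times> K)"
      using cancel triv by (fastforce simp: inj_on_def)
    moreover have "(\<lambda>(h, k). h \<otimes> k) ` (H \<times> K) \<subseteq> carrier G"
      using subgroup.subset[OF H] subgroup.subset[OF K] by auto
    ultimately have "card (H \<times> K) \<le> order G"
      unfolding order_def using fin by (metis card_inj_on_le)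
    then show False using card by (simp add: card_cartesian_product)
  qed
  then show ?thesis using that by blast
qed

lemma C8_embedding:
  assumes "embeddable (integer_mod_group 8) G"
  obtains y where "y \<in> carrier G" "ord y = 8"
proof -
  obtain f where f: "f \<in> hom (integer_mod_group 8) G" "inj_on f (carrier (integer_mod_group 8))"
    using assms by (rule embeddable_imp_hom)
  interpret f: group_hom "integer_mod_group 8" G f
    using f(1) by (simp add: group_hom_def group_hom_axioms_def is_group)
  have "f 1 [^] n = \<one> \<longleftrightarrow> 8 dvd n" for n :: nat
  proof -
    have "f 1 [^] n = f (int n mod 8)" using f.hom_nat_pow[of 1 n] by simp
    also have "\<dots> = \<one> \<longleftrightarrow> int n mod 8 = 0"
      using inj_on_eq_iff[OF f(2), of "int n mod 8" 0] f.hom_one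
      by (simp add: carrier_integer_mod_group)
    finally show ?thesis by presburger
  qed
  moreover have "f 1 \<in> carrier G" by simp
  ultimately show ?thesis using that ord_unique by blast
qed

lemma elementary_abelian_embedding:
  assumes "embeddable (C2 \<times>\<times> (C2 \<times>\<times> C2)) G"
  obtains E where "subgroup E G" "card E = 8" "\<And>g. g \<in> E \<Longrightarrow> g \<otimes> g = \<one>"
proof -
  let ?K = "C2 \<times>\<times> (C2 \<times>\<times> C2)"
  have K: "group ?K" by (intro DirProd_group) simp_all
  obtain f where f: "f \<in> hom ?K G" "inj_on f (carrier ?K)"
    using assms by (rule embeddable_imp_hom)
  interpret f: group_hom ?K G f
    using f(1) K by (simp add: group_hom_def group_hom_axioms_def is_group)
  have "f k \<otimes> f k = \<one>" if k: "k \<in> carrier ?K" for k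
  proof -
    have "k \<otimes>\<^bsub>?K\<^esub> k = \<one>\<^bsub>?K\<^esub>" by (cases k) (simp add: mult_2[symmetric])
    then show ?thesis using f.hom_mult[OF k k] f.hom_one by metis
  qed
  moreover have "card (f ` carrier ?K) = 8"
    using f(2) by (simp add: card_image card_cartesian_product carrier_integer_mod_group)
  ultimately show ?thesis using that f.img_is_subgroup by blast
qed

text \<open>
  The properties of the quaternion group that enter: \<open>u\<close> and \<open>v\<close> play the roles of \<open>i\<close> and \<open>j\<close>,
  and \<open>u \<otimes> u\<close> is \<open>-1\<close>. By the last one, \<open>-1\<close> lies in every nontrivial subgroup.
\<close>

lemma Q8_embedding:
  assumes "embeddable Q8 G"
  obtains Q u v where "subgroup Q G" "card Q = 8" "u \<in> Q" "v \<in> Q" "v \<otimes> v = u \<otimes> u"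
    "u \<otimes> u \<noteq> \<one>" "(u \<otimes> u) \<otimes> (u \<otimes> u) = \<one>" "u \<otimes> v \<noteq> v \<otimes> u"
    "\<forall>g\<in>Q - {\<one>}. g = u \<otimes> u \<or> g \<otimes> g = u \<otimes> u"
proof -
  obtain f where f: "f \<in> hom Q8 G" "inj_on f (carrier Q8)"
    using assms by (rule embeddable_imp_hom)
  interpret f: group_hom Q8 G f
    using f(1) group_Q8 by (simp add: group_hom_def group_hom_axioms_def is_group)
  let ?i = "(0,1,0,0) :: quat" and ?j = "(0,0,1,0) :: quat" and ?w = "(-1,0,0,0) :: quat"
  have mem: "?i \<in> carrier Q8" "?j \<in> carrier Q8" "?w \<in> carrier Q8" by (simp_all add: Q8_def)
  have eq: "f p = f q \<longleftrightarrow> p = q" if "p \<in> carrier Q8" "q \<in> carrier Q8" for p q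
    using inj_on_eq_iff[OF f(2) that] .
  have w: "f ?i \<otimes> f ?i = f ?w" "f ?j \<otimes> f ?j = f ?w"
    using mem by (simp_all flip: f.hom_mult) (simp_all add: Q8_def)
  have one: "f (1,0,0,0) = \<one>" using f.hom_one by (simp add: Q8_def)
  have "f ?w \<noteq> \<one>" using eq[OF mem(3), of "(1,0,0,0)"] one by (simp add: Q8_def)
  moreover have "f ?w \<otimes> f ?w = \<one>"
    using f.hom_mult[OF mem(3,3)] one by (simp add: Q8_def)
  moreover have "f ?i \<otimes> f ?j \<noteq> f ?j \<otimes> f ?i"
    using f.hom_mult[OF mem(1,2)] f.hom_mult[OF mem(2,1)]
      eq[of "?i \<otimes>\<^bsub>Q8\<^esub> ?j" "?j \<otimes>\<^bsub>Q8\<^esub> ?i"] mem by (simp add: Q8_def)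
  moreover have "g = f ?w \<or> g \<otimes> g = f ?w" if g: "g \<in> f ` carrier Q8" "g \<noteq> \<one>" for g
  proof -
    obtain p where p: "p \<in> carrier Q8" "g = f p" using g(1) by blast
    then have "p \<noteq> \<one>\<^bsub>Q8\<^esub>" using g(2) by auto
    then have "p = ?w \<or> p \<otimes>\<^bsub>Q8\<^esub> p = ?w" using p(1) by (auto simp: Q8_def)
    then show ?thesis using p(2) f.hom_mult[OF p(1) p(1)] by metis
  qed
  moreover have "card (f ` carrier Q8) = 8"
    using order_Q8 f(2) by (simp add: card_image order_def)
  ultimately show ?thesis
    using that[OF f.img_is_subgroup, of "f ?i" "f ?j"] mem w by auto
qed

lemma card_cyclic:
  assumes "y \<in> carrier G" shows "card (range (\<lambda>n::int. y [^] n)) = ord y"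
  using cyclic_order_is_ord[OF assms] carrier_subgroup_generated_by_singleton[OF assms]
  by (simp add: order_def)

lemma involution_in_cyclic_8:
  assumes y: "y \<in> carrier G" "ord y = 8"
    and g: "g \<in> range (\<lambda>n::int. y [^] n)" "g \<noteq> \<one>" "g \<otimes> g = \<one>"
  shows "g = y [^] (4::int)"
proof -
  obtain n :: int where n: "g = y [^] n" using g(1) by blast
  have "\<not> 8 dvd n" using g(2) n y by (simp add: int_pow_eq_id)
  moreover have "y [^] (n + n) = \<one>" using g(3) unfolding n int_pow_mult[OF y(1)] .
  then have "8 dvd n + n" using y by (simp add: int_pow_eq_id)
  ultimately have "8 dvd 4 - n" by presburger
  then show ?thesis unfolding n int_pow_eq[OF y(1)] y(2) by simp
qed

text \<open>
  Over the field with two elements this is the choice of a plane that misses the vector \<open>z\<close>: take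
  \<open>a\<close> outside the span of \<open>z\<close> and \<open>b\<close> outside the span of \<open>a\<close> and \<open>z\<close>.
\<close>

lemma klein_complement:
  assumes E: "subgroup E G" "card E = 8" "\<And>g. g \<in> E \<Longrightarrow> g \<otimes> g = \<one>" and z: "z \<in> E" "z \<noteq> \<one>"
  obtains A where "subgroup A G" "A \<subseteq> E" "card A = 4" "z \<notin> A"
proof -
  interpret E: subgroup E G by (rule E(1))
  have Ec: "g \<in> carrier G" if "g \<in> E" for g using that by simp
  have inv: "inv g = g" if "g \<in> E" for g using that E(3) Ec by (simp add: inv_equality)
  have comm: "g \<otimes> h = h \<otimes> g" if "g \<in> E" "h \<in> E" for g h
    using that by (metis inv inv_mult_group Ec E.m_closed)
  have cancel: "g \<otimes> (g \<otimes> h) = h" if "g \<in> E" "h \<in> carrier G" for g h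
    using that E(3) Ec by (simp flip: m_assoc)
  have fin: "finite E" using E(2) card.infinite by fastforce
  have pick: "\<exists>g\<in>E. g \<notin> set xs" if "length xs < 8" for xs
  proof (rule ccontr)
    assume "\<not> ?thesis"
    then have "card E \<le> card (set xs)" by (intro card_mono) auto
    then show False using that E(2) card_length[of xs] by linarith
  qed
  obtain a where a: "a \<in> E" "a \<noteq> \<one>" "a \<noteq> z" using pick[of "[\<one>, z]"] by auto
  obtain b where b: "b \<in> E" "b \<noteq> \<one>" "b \<noteq> z" "b \<noteq> a" "b \<noteq> a \<otimes> z"
    using pick[of "[\<one>, z, a, a \<otimes> z]"] by auto
  let ?A = "{\<one>, a, b, a \<otimes> b}"
  have ab: "a \<otimes> b \<noteq> x" if "b \<noteq> a \<otimes> x" "x \<in> E" for x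
    using that cancel[OF a(1) Ec[OF b(1)]] by metis
  have ne: "a \<otimes> b \<noteq> \<one>" "a \<otimes> b \<noteq> z" using ab[of \<one>] ab[of z] a b z Ec by auto
  have ne': "a \<otimes> b \<noteq> a" "a \<otimes> b \<noteq> b" using a b Ec by auto
  have "subgroup ?A G"
  proof (rule subgroupI)
    show "?A \<subseteq> carrier G" using a b Ec by auto
    show "?A \<noteq> {}" by simp
    fix g assume g: "g \<in> ?A"
    then have "g \<in> E" using a b by auto
    then show "inv g \<in> ?A" using inv g by simp
    fix h assume h: "h \<in> ?A"
    have ba: "b \<otimes> a = a \<otimes> b" using comm a b by blast
    have bab: "b \<otimes> (a \<otimes> b) = a" using comm[OF b(1), of "a \<otimes> b"] a b Ec E(3)[OF b(1)] by (simp add: m_assoc)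
    have aab: "a \<otimes> (a \<otimes> b) = b" using cancel[OF a(1) Ec[OF b(1)]] .
    have "a \<otimes> b \<otimes> a = b" "a \<otimes> b \<otimes> b = a" "a \<otimes> b \<otimes> (a \<otimes> b) = \<one>"
      using a b Ec E(3) by (simp_all add: m_assoc ba aab bab)
    then show "g \<otimes> h \<in> ?A"
      using g h ba bab aab E(3)[OF a(1)] E(3)[OF b(1)] Ec[OF a(1)] Ec[OF b(1)]
      by (elim insertE) simp_all
  qed
  moreover have "?A \<subseteq> E" using a b by auto
  moreover have "card ?A = 4" using a b ne ne' by (simp add: card_insert_if)
  moreover have "z \<notin> ?A" using a b ne z by auto
  ultimately show ?thesis by (rule that)
qed

theorem order_32_classification:
  assumes order: "order G = 32" and all: "all_groups_embeddable 8 G"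
  shows "G \<cong> C2 \<times>\<times> H1 \<or> G \<cong> H2"
proof -
  have fin: "finite (carrier G)" using order by (metis order_gt_0_iff_finite zero_less_numeral)
  note embed = all_groups_embeddable_any_type[OF all]
  have "group (C2 \<times>\<times> (C2 \<times>\<times> C2))" by (intro DirProd_group) simp_all
  moreover have "order (C2 \<times>\<times> (C2 \<times>\<times> C2)) = 8"
    by (simp add: order_def card_cartesian_product carrier_integer_mod_group)
  ultimately obtain E where E: "subgroup E G" "card E = 8" "\<And>g. g \<in> E \<Longrightarrow> g \<otimes> g = \<one>"
    using embed elementary_abelian_embedding by (metis zero_less_numeral)
  have "order (integer_mod_group 8) = 8" by (simp add: order_def carrier_integer_mod_group)
  then obtain y where y: "y \<in> carrier G" "ord y = 8"
    using embed C8_embedding group_integer_mod_group by (metis zero_less_numeral)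
  have "embeddable Q8 G" using embed[OF group_Q8 order_Q8] by simp
  then obtain Q u v where Q: "subgroup Q G" "card Q = 8" "u \<in> Q" "v \<in> Q" "v \<otimes> v = u \<otimes> u"
      "u \<otimes> u \<noteq> \<one>" "(u \<otimes> u) \<otimes> (u \<otimes> u) = \<one>" "u \<otimes> v \<noteq> v \<otimes> u"
    and Qw: "\<forall>g\<in>Q - {\<one>}. g = u \<otimes> u \<or> g \<otimes> g = u \<otimes> u"
    by (rule Q8_embedding)
  define Y where "Y = range (\<lambda>n::int. y [^] n)"
  define z where "z = y [^] (4::int)"
  have Y: "subgroup Y G" "card Y = 8"
    using subgroup_of_powers card_cyclic y by (simp_all add: Y_def)
  have invol: "g = z" if "g \<in> Y" "g \<noteq> \<one>" "g \<otimes> g = \<one>" for g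
    using involution_in_cyclic_8[OF y] that by (simp add: Y_def z_def)
  obtain q where q: "q \<in> Q" "q \<in> Y" "q \<noteq> \<one>"
    using large_subgroups_meet[OF Q(1) Y(1) fin] Q(2) Y(2) order by auto
  have "q = u \<otimes> u \<or> q \<otimes> q = u \<otimes> u" using Qw q by blast
  then have "u \<otimes> u \<in> Y" using q(2) subgroup.m_closed[OF Y(1) q(2) q(2)] by metis
  then have u: "u \<otimes> u = z" using invol Q(6,7) by blast
  obtain e where e: "e \<in> E" "e \<in> Y" "e \<noteq> \<one>"
    using large_subgroups_meet[OF E(1) Y(1) fin] E(2) Y(2) order by auto
  then have "z \<in> E" "z \<noteq> \<one>" using invol E(3) by auto
  then obtain A where A: "subgroup A G" "A \<subseteq> E" "card A = 4" "z \<notin> A"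
    using klein_complement[OF E] by blast
  \<comment> \<open>elements of \<open>A\<close> square to 1, and the only involution of \<open>Y\<close> is \<open>z\<close>\<close>
  have "A \<inter> Y \<subseteq> {\<one>}" using A invol E(3) by blast
  then interpret klein_octic G A y
    using A E(3) y order by (intro klein_octic.intro is_group klein_octic_axioms.intro) (auto simp: Y_def)
  have uv: "u \<in> carrier G" "v \<in> carrier G" using Q subgroup.mem_carrier by fastforce+
  obtain c where c: "c \<in> A" "y \<otimes> c = c \<otimes> y [^] (3::int)"
    and norm: "\<And>d. d \<in> A \<Longrightarrow> \<exists>i::int. y \<otimes> d = d \<otimes> y [^] i"
    using ex_cubing[OF uv Q(8)] u Q(5) unfolding z_def by metis
  obtain d i where d: "A = {\<one>, c, d, c \<otimes> d}" "y \<otimes> d = d \<otimes> y [^] (i::int)" "i = 1 \<or> i = 5"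
    using ex_complementary_action[OF c norm] by metis
  from d(3) show ?thesis
  proof
    assume "i = 1"
    then have "y \<otimes> d = d \<otimes> y" using d(2) by simp
    then show ?thesis using iso_C2_times_H1[OF d(1) c(2)] by blast
  next
    assume "i = 5"
    then show ?thesis using iso_H2[OF d(1) c(2)] d(2) by blast
  qed
qed

end

theorem theorem1:
  fixes G :: "('a, 'm) monoid_scheme"
  assumes "group G" and "order G = 32" and "all_groups_embeddable 8 G"
  shows "G \<cong> C2 \<times>\<times> H1 \<or> G \<cong> H2"
  using assms by (rule group.order_32_classification)

end
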